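(* Let $\mathsf{X}$ be a category with a topological functor $|\text{-}|\colon\mathsf{X}\to\mathsf{Set}$. Then the category $\mathsf{X}\text{-}\mathsf{Equ}$ of equilogical objects of $\mathsf{X}$ is complete, cocomplete, regular well-powered and regular co-well-powered.
   Context: A functor $|\text{-}|\colon\mathsf{X}\to\mathsf{Set}$ is topological if every (possibly large) $|\text{-}|$-structured source $(A\to|X_i|)_{i}$ has a unique $|\text{-}|$-initial lifting; in particular $|\text{-}|$ is faithful, $\mathsf{X}$ is complete and cocomplete, and $|\text{-}|$ preserves limits and colimits. The category $\mathsf{X}\text{-}\mathsf{Equ}$: objects (equilogical objects of $\mathsf{X}$) are pairs $\mathcal{X}=\langle X,\equiv_{|X|}\rangle$ with $X$ an object of $\mathsf{X}$ and $\equiv_{|X|}$ an equivalence relation on the set $|X|$. A morphism from $\langle X,\equiv_{|X|}\rangle$ to $\langle Y,\equiv_{|Y|}\rangle$ is an equivalence class $[f]$ of morphisms $f\colon X\to Y$ of $\mathsf{X}$ such that $|f|$ is equivariant, i.e. $x\equiv_{|X|}x'$ implies $|f|(x)\equiv_{|Y|}|f|(x')$ for all $x,x'\in|X|$; two such $f,g$ are equivalent iff for all $x,x'\in|X|$, $x\equiv_{|X|}x'$ implies $|f|(x)\equiv_{|Y|}|g|(x')$. The identity is $[1_X]$ and composition is $[g]\cdot[f]=[g\cdot f]$. A category is regular well-powered (resp. regular co-well-powered) if for each object the regular subobjects (resp. regular quotients), i.e. isomorphism classes of regular monomorphisms into it (resp. regular epimorphisms out of it), form a set. *)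

theory Defs
  imports Main "HOL-Library.FuncSet" "HOL-Library.Equipollence"
begin

section \<open>Size\<close>

text \<open>
  The type \<open>'u\<close> plays the role of the class of all sets: a collection is a set in the sense of
  the ambient set theory (\<open>small\<close>) iff it has strictly fewer elements than \<open>'u\<close>. The two closure
  conditions are those of a Grothendieck universe (the cardinal of \<open>'u\<close> is regular and a strong
  limit; it is then automatically infinite). For uncountable \<open>'u\<close> they say that the cardinal of
  \<open>'u\<close> is inaccessible; uncountability is not demanded, so that hereditarily finite sets are
  covered too and the conditions are satisfiable in HOL.
\<close>

definition small :: "'u itself \<Rightarrow> 'b set \<Rightarrow> bool" where
  "small _ A \<longleftrightarrow> A \<prec> (UNIV :: 'u set)"

definition universe :: "'u itself \<Rightarrow> bool" where
  "universe u \<longleftrightarrow>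
     (\<forall>A :: 'u set. small u A \<longrightarrow> small u (Pow A)) \<and>
     (\<forall>(I :: 'u set) (F :: 'u \<Rightarrow> 'u set).
        small u I \<and> (\<forall>i\<in>I. small u (F i)) \<longrightarrow> small u (\<Union>i\<in>I. F i))"

lemma small_nat_iff: "small TYPE(nat) A \<longleftrightarrow> finite A"
proof
  assume "finite A"
  then show "small TYPE(nat) A"
    by (simp add: small_def finite_lesspoll_infinite)
next
  assume small: "small TYPE(nat) A"
  show "finite A"
  proof (rule ccontr)
    assume "infinite A"
    then have "(UNIV :: nat set) \<lesssim> A" by (simp add: infinite_le_lepoll)
    then show False
      using small by (auto simp: small_def lesspoll_def intro: lepoll_antisym)
  qed
qed

lemma universe_nat: "universe TYPE(nat)"
  by (simp add: universe_def small_nat_iff)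


section \<open>Categories and functors\<close>

record ('o, 'a) cat =
  Ob :: "'o set"
  Ar :: "'a set"
  Dom :: "'a \<Rightarrow> 'o"
  Cod :: "'a \<Rightarrow> 'o"
  Ide :: "'o \<Rightarrow> 'a"
  Comp :: "'a \<Rightarrow> 'a \<Rightarrow> 'a"

text \<open>\<open>Comp C g f\<close> is ``first \<open>f\<close>, then \<open>g\<close>''; it is meaningful only if \<open>Dom C g = Cod C f\<close>.\<close>

definition hom :: "('o, 'a) cat \<Rightarrow> 'o \<Rightarrow> 'o \<Rightarrow> 'a set" where
  "hom C a b = {f \<in> Ar C. Dom C f = a \<and> Cod C f = b}"

locale category =
  fixes C :: "('o, 'a) cat"
  assumes Dom_Ob: "f \<in> Ar C \<Longrightarrow> Dom C f \<in> Ob C"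
    and Cod_Ob: "f \<in> Ar C \<Longrightarrow> Cod C f \<in> Ob C"
    and Ide_hom: "a \<in> Ob C \<Longrightarrow> Ide C a \<in> hom C a a"
    and Comp_hom: "f \<in> hom C a b \<Longrightarrow> g \<in> hom C b c \<Longrightarrow> Comp C g f \<in> hom C a c"
    and Comp_Ide: "f \<in> hom C a b \<Longrightarrow> Comp C f (Ide C a) = f"
    and Ide_Comp: "f \<in> hom C a b \<Longrightarrow> Comp C (Ide C b) f = f"
    and Comp_assoc: "f \<in> hom C a b \<Longrightarrow> g \<in> hom C b c \<Longrightarrow> h \<in> hom C c d \<Longrightarrow>
      Comp C h (Comp C g f) = Comp C (Comp C h g) f"

definition is_functor ::
    "('o, 'a) cat \<Rightarrow> ('p, 'b) cat \<Rightarrow> ('o \<Rightarrow> 'p) \<Rightarrow> ('a \<Rightarrow> 'b) \<Rightarrow> bool" where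
  "is_functor C D Fo Fa \<longleftrightarrow>
     (\<forall>a\<in>Ob C. Fo a \<in> Ob D \<and> Fa (Ide C a) = Ide D (Fo a)) \<and>
     (\<forall>a\<in>Ob C. \<forall>b\<in>Ob C. \<forall>f\<in>hom C a b. Fa f \<in> hom D (Fo a) (Fo b)) \<and>
     (\<forall>a\<in>Ob C. \<forall>b\<in>Ob C. \<forall>c\<in>Ob C. \<forall>f\<in>hom C a b. \<forall>g\<in>hom C b c.
        Fa (Comp C g f) = Comp D (Fa g) (Fa f))"

definition iso :: "('o, 'a) cat \<Rightarrow> 'a \<Rightarrow> bool" where
  "iso C i \<longleftrightarrow> i \<in> Ar C \<and>
     (\<exists>j \<in> hom C (Cod C i) (Dom C i).
        Comp C j i = Ide C (Dom C i) \<and> Comp C i j = Ide C (Cod C i))"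


section \<open>The category of sets\<close>

text \<open>
  A map is a triple of domain, underlying function and codomain; the function is
  \<open>undefined\<close> outside the domain, so that equality of maps is extensional.
\<close>

type_synonym 'u map = "'u set \<times> ('u \<Rightarrow> 'u) \<times> 'u set"

definition fun_of :: "'u map \<Rightarrow> 'u \<Rightarrow> 'u" where
  "fun_of k = fst (snd k)"

definition Sets :: "('u set, 'u map) cat" where
  "Sets = \<lparr>
     Ob = {A. small TYPE('u) A},
     Ar = {(A, k, B). small TYPE('u) A \<and> small TYPE('u) B \<and> k \<in> A \<rightarrow>\<^sub>E B},
     Dom = fst,
     Cod = (\<lambda>k. snd (snd k)),
     Ide = (\<lambda>A. (A, restrict id A, A)),
     Comp = (\<lambda>g f. (fst f, compose (fst f) (fun_of g) (fun_of f), snd (snd g)))\<rparr>"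


lemma category_Sets: "category (Sets :: ('b set, 'b map) cat)"
proof -
  have hom: "k \<in> hom Sets A B \<longleftrightarrow> small TYPE('b) A \<and> small TYPE('b) B \<and>
      (\<exists>\<kappa> \<in> A \<rightarrow>\<^sub>E B. k = (A, \<kappa>, B))" for k A and B :: "'b set"
    by (auto simp: Sets_def hom_def)
  have Comp: "Comp Sets (B, g, D) (A, f, B') = (A, compose A g f, D)"
    for f g and A B B' D :: "'b set"
    by (simp add: Sets_def fun_of_def)
  have Ide: "Ide Sets A = (A, restrict id A, A)" for A :: "'b set"
    by (simp add: Sets_def)
  have compose: "compose A g f \<in> A \<rightarrow>\<^sub>E D" if "f \<in> A \<rightarrow>\<^sub>E B" "g \<in> B \<rightarrow>\<^sub>E D"
    for f g and A B D :: "'b set"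
    using that by (auto simp: compose_def)
  show "category (Sets :: ('b set, 'b map) cat)"
  proof
    fix f :: "'b map" assume "f \<in> Ar Sets"
    then show "Dom Sets f \<in> Ob Sets" "Cod Sets f \<in> Ob Sets" by (auto simp: Sets_def)
  next
    fix a :: "'b set" assume "a \<in> Ob Sets"
    then show "Ide Sets a \<in> hom Sets a a" by (auto simp: Sets_def hom_def)
  next
    fix f g :: "'b map" and a b c assume "f \<in> hom Sets a b" "g \<in> hom Sets b c"
    then show "Comp Sets g f \<in> hom Sets a c"
      using compose by (auto simp: hom Comp)
  next
    fix f :: "'b map" and a b assume "f \<in> hom Sets a b"
    then obtain k where k: "f = (a, k, b)" "k \<in> a \<rightarrow>\<^sub>E b" by (auto simp: hom)
    have "compose a k (restrict id a) = k" "compose a (restrict id b) k = k"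
      using k(2) by (auto simp: compose_def fun_eq_iff PiE_def extensional_def)
    then show "Comp Sets f (Ide Sets a) = f" "Comp Sets (Ide Sets b) f = f"
      by (simp_all add: k(1) Ide Comp)
  next
    fix f g h :: "'b map" and a b c d
    assume "f \<in> hom Sets a b" "g \<in> hom Sets b c" "h \<in> hom Sets c d"
    then show "Comp Sets h (Comp Sets g f) = Comp Sets (Comp Sets h g) f"
      by (auto simp: hom Comp compose_def fun_eq_iff)
  qed
qed


section \<open>Topological functors\<close>

definition initial_source ::
    "('o, 'a) cat \<Rightarrow> ('p, 'b) cat \<Rightarrow> ('o \<Rightarrow> 'p) \<Rightarrow> ('a \<Rightarrow> 'b) \<Rightarrow>
     'o \<Rightarrow> 'i set \<Rightarrow> ('i \<Rightarrow> 'o) \<Rightarrow> ('i \<Rightarrow> 'a) \<Rightarrow> bool" where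
  "initial_source C D Fo Fa a I Xs \<phi> \<longleftrightarrow>
     a \<in> Ob C \<and> (\<forall>i\<in>I. Xs i \<in> Ob C \<and> \<phi> i \<in> hom C a (Xs i)) \<and>
     (\<forall>z\<in>Ob C. \<forall>\<gamma>. \<forall>h \<in> hom D (Fo z) (Fo a).
        (\<forall>i\<in>I. \<gamma> i \<in> hom C z (Xs i) \<and> Fa (\<gamma> i) = Comp D (Fa (\<phi> i)) h) \<longrightarrow>
        (\<exists>!k. k \<in> hom C z a \<and> Fa k = h \<and> (\<forall>i\<in>I. \<gamma> i = Comp C (\<phi> i) k)))"

text \<open>
  The \<open>I\<close>-indexed structured source \<open>f i : A \<rightarrow> Fo (Xs i)\<close> has exactly one initial lifting; \<open>\<phi>\<close> is
  made extensional because only its values on \<open>I\<close> matter.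
\<close>

definition unique_initial_lifting ::
    "('o, 'a) cat \<Rightarrow> ('p, 'b) cat \<Rightarrow> ('o \<Rightarrow> 'p) \<Rightarrow> ('a \<Rightarrow> 'b) \<Rightarrow>
     'p \<Rightarrow> 'i set \<Rightarrow> ('i \<Rightarrow> 'o) \<Rightarrow> ('i \<Rightarrow> 'b) \<Rightarrow> bool" where
  "unique_initial_lifting C D Fo Fa A I Xs f \<longleftrightarrow>
     (\<exists>!(a, \<phi>). initial_source C D Fo Fa a I Xs \<phi> \<and> \<phi> \<in> extensional I \<and>
        Fo a = A \<and> (\<forall>i\<in>I. Fa (\<phi> i) = f i))"

text \<open>
  HOL cannot quantify over the type of the indices, so the (possibly large) index collections are
  the subsets of the type \<open>'a\<close> of arrows of \<open>C\<close>. This is no restriction: lifting one-element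
  sources embeds the structured arrows \<open>(x, k : A \<rightarrow> Fo x)\<close> with fixed \<open>A\<close> into \<open>Ar C\<close>, so every
  family without repetitions is covered, and the families indexed by \<open>Ar C\<close> itself force the
  functor to be faithful, after which repetitions do not matter. Indexing by sets of structured
  arrows instead would exclude repetitions and lose faithfulness.
\<close>

definition topological ::
    "('o, 'a) cat \<Rightarrow> ('p, 'b) cat \<Rightarrow> ('o \<Rightarrow> 'p) \<Rightarrow> ('a \<Rightarrow> 'b) \<Rightarrow> bool" where
  "topological C D Fo Fa \<longleftrightarrow> is_functor C D Fo Fa \<and>
     (\<forall>A\<in>Ob D. \<forall>(I :: 'a set) Xs f.
        (\<forall>i\<in>I. Xs i \<in> Ob C \<and> f i \<in> hom D A (Fo (Xs i))) \<longrightarrow>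
        unique_initial_lifting C D Fo Fa A I Xs f)"


section \<open>Limits and colimits\<close>

text \<open>A small category is represented, up to isomorphism, with objects and arrows taken from \<open>'u\<close>.\<close>

definition small_diagram ::
    "('u, 'u) cat \<Rightarrow> ('o, 'a) cat \<Rightarrow> ('u \<Rightarrow> 'o) \<Rightarrow> ('u \<Rightarrow> 'a) \<Rightarrow> bool" where
  "small_diagram J C Do Da \<longleftrightarrow> category J \<and> small TYPE('u) (Ob J) \<and> small TYPE('u) (Ar J) \<and>
     is_functor J C Do Da"

definition is_cone ::
    "('j, 'k) cat \<Rightarrow> ('o, 'a) cat \<Rightarrow> ('j \<Rightarrow> 'o) \<Rightarrow> ('k \<Rightarrow> 'a) \<Rightarrow> 'o \<Rightarrow> ('j \<Rightarrow> 'a) \<Rightarrow> bool" where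
  "is_cone J C Do Da l \<pi> \<longleftrightarrow> l \<in> Ob C \<and> (\<forall>j\<in>Ob J. \<pi> j \<in> hom C l (Do j)) \<and>
     (\<forall>k\<in>Ar J. Comp C (Da k) (\<pi> (Dom J k)) = \<pi> (Cod J k))"

definition is_limit ::
    "('j, 'k) cat \<Rightarrow> ('o, 'a) cat \<Rightarrow> ('j \<Rightarrow> 'o) \<Rightarrow> ('k \<Rightarrow> 'a) \<Rightarrow> 'o \<Rightarrow> ('j \<Rightarrow> 'a) \<Rightarrow> bool" where
  "is_limit J C Do Da l \<pi> \<longleftrightarrow> is_cone J C Do Da l \<pi> \<and>
     (\<forall>m \<mu>. is_cone J C Do Da m \<mu> \<longrightarrow>
        (\<exists>!h. h \<in> hom C m l \<and> (\<forall>j\<in>Ob J. Comp C (\<pi> j) h = \<mu> j)))"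

definition complete_category :: "'u itself \<Rightarrow> ('o, 'a) cat \<Rightarrow> bool" where
  "complete_category _ C \<longleftrightarrow>
     (\<forall>(J :: ('u, 'u) cat) Do Da. small_diagram J C Do Da \<longrightarrow> (\<exists>l \<pi>. is_limit J C Do Da l \<pi>))"

definition is_cocone ::
    "('j, 'k) cat \<Rightarrow> ('o, 'a) cat \<Rightarrow> ('j \<Rightarrow> 'o) \<Rightarrow> ('k \<Rightarrow> 'a) \<Rightarrow> 'o \<Rightarrow> ('j \<Rightarrow> 'a) \<Rightarrow> bool" where
  "is_cocone J C Do Da l \<iota> \<longleftrightarrow> l \<in> Ob C \<and> (\<forall>j\<in>Ob J. \<iota> j \<in> hom C (Do j) l) \<and>
     (\<forall>k\<in>Ar J. Comp C (\<iota> (Cod J k)) (Da k) = \<iota> (Dom J k))"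

definition is_colimit ::
    "('j, 'k) cat \<Rightarrow> ('o, 'a) cat \<Rightarrow> ('j \<Rightarrow> 'o) \<Rightarrow> ('k \<Rightarrow> 'a) \<Rightarrow> 'o \<Rightarrow> ('j \<Rightarrow> 'a) \<Rightarrow> bool" where
  "is_colimit J C Do Da l \<iota> \<longleftrightarrow> is_cocone J C Do Da l \<iota> \<and>
     (\<forall>m \<mu>. is_cocone J C Do Da m \<mu> \<longrightarrow>
        (\<exists>!h. h \<in> hom C l m \<and> (\<forall>j\<in>Ob J. Comp C h (\<iota> j) = \<mu> j)))"

definition cocomplete_category :: "'u itself \<Rightarrow> ('o, 'a) cat \<Rightarrow> bool" where
  "cocomplete_category _ C \<longleftrightarrow>
     (\<forall>(J :: ('u, 'u) cat) Do Da. small_diagram J C Do Da \<longrightarrow> (\<exists>l \<iota>. is_colimit J C Do Da l \<iota>))"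


section \<open>Regular subobjects and regular quotients\<close>

definition is_equalizer :: "('o, 'a) cat \<Rightarrow> 'a \<Rightarrow> 'a \<Rightarrow> 'a \<Rightarrow> bool" where
  "is_equalizer C f g m \<longleftrightarrow> m \<in> Ar C \<and> Comp C f m = Comp C g m \<and>
     (\<forall>z\<in>Ob C. \<forall>h \<in> hom C z (Cod C m). Comp C f h = Comp C g h \<longrightarrow>
        (\<exists>!k. k \<in> hom C z (Dom C m) \<and> Comp C m k = h))"

definition regular_mono :: "('o, 'a) cat \<Rightarrow> 'a \<Rightarrow> bool" where
  "regular_mono C m \<longleftrightarrow> m \<in> Ar C \<and>
     (\<exists>c\<in>Ob C. \<exists>f \<in> hom C (Cod C m) c. \<exists>g \<in> hom C (Cod C m) c. is_equalizer C f g m)"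

definition is_coequalizer :: "('o, 'a) cat \<Rightarrow> 'a \<Rightarrow> 'a \<Rightarrow> 'a \<Rightarrow> bool" where
  "is_coequalizer C f g e \<longleftrightarrow> e \<in> Ar C \<and> Comp C e f = Comp C e g \<and>
     (\<forall>z\<in>Ob C. \<forall>h \<in> hom C (Dom C e) z. Comp C h f = Comp C h g \<longrightarrow>
        (\<exists>!k. k \<in> hom C (Cod C e) z \<and> Comp C k e = h))"

definition regular_epi :: "('o, 'a) cat \<Rightarrow> 'a \<Rightarrow> bool" where
  "regular_epi C e \<longleftrightarrow> e \<in> Ar C \<and>
     (\<exists>c\<in>Ob C. \<exists>f \<in> hom C c (Dom C e). \<exists>g \<in> hom C c (Dom C e). is_coequalizer C f g e)"

definition regular_monos_into :: "('o, 'a) cat \<Rightarrow> 'o \<Rightarrow> 'a set" where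
  "regular_monos_into C b = {m \<in> Ar C. Cod C m = b \<and> regular_mono C m}"

definition iso_over :: "('o, 'a) cat \<Rightarrow> 'o \<Rightarrow> ('a \<times> 'a) set" where
  "iso_over C b = {(m, n). m \<in> Ar C \<and> n \<in> Ar C \<and> Cod C m = b \<and> Cod C n = b \<and>
     (\<exists>i \<in> hom C (Dom C m) (Dom C n). iso C i \<and> Comp C n i = m)}"

definition regular_epis_from :: "('o, 'a) cat \<Rightarrow> 'o \<Rightarrow> 'a set" where
  "regular_epis_from C a = {e \<in> Ar C. Dom C e = a \<and> regular_epi C e}"

definition iso_under :: "('o, 'a) cat \<Rightarrow> 'o \<Rightarrow> ('a \<times> 'a) set" where
  "iso_under C a = {(d, e). d \<in> Ar C \<and> e \<in> Ar C \<and> Dom C d = a \<and> Dom C e = a \<and>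
     (\<exists>i \<in> hom C (Cod C d) (Cod C e). iso C i \<and> Comp C i d = e)}"

text \<open>
  The isomorphism classes may themselves be large; that they form a set is a statement about how
  many of them there are.
\<close>

definition regular_well_powered :: "'u itself \<Rightarrow> ('o, 'a) cat \<Rightarrow> bool" where
  "regular_well_powered u C \<longleftrightarrow>
     (\<forall>b\<in>Ob C. small u (regular_monos_into C b // iso_over C b))"

definition regular_co_well_powered :: "'u itself \<Rightarrow> ('o, 'a) cat \<Rightarrow> bool" where
  "regular_co_well_powered u C \<longleftrightarrow>
     (\<forall>a\<in>Ob C. small u (regular_epis_from C a // iso_under C a))"


section \<open>Equilogical objects\<close>

type_synonym ('o, 'u) equ_ob = "'o \<times> 'u rel"

text \<open>Source and target are part of an arrow, since one class of arrows of \<open>X\<close> can occur between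
  different equilogical objects.\<close>

type_synonym ('o, 'a, 'u) equ_ar = "('o, 'u) equ_ob \<times> 'a set \<times> ('o, 'u) equ_ob"

definition equivariant ::
    "('o, 'a) cat \<Rightarrow> ('a \<Rightarrow> 'u map) \<Rightarrow> ('o, 'u) equ_ob \<Rightarrow> ('o, 'u) equ_ob \<Rightarrow> 'a set" where
  "equivariant X Ua S T = {f \<in> hom X (fst S) (fst T).
     \<forall>(x, x') \<in> snd S. (fun_of (Ua f) x, fun_of (Ua f) x') \<in> snd T}"

definition equ_rel ::
    "('o, 'a) cat \<Rightarrow> ('a \<Rightarrow> 'u map) \<Rightarrow> ('o, 'u) equ_ob \<Rightarrow> ('o, 'u) equ_ob \<Rightarrow> 'a rel" where
  "equ_rel X Ua S T = {(f, g). f \<in> equivariant X Ua S T \<and> g \<in> equivariant X Ua S T \<and>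
     (\<forall>(x, x') \<in> snd S. (fun_of (Ua f) x, fun_of (Ua g) x') \<in> snd T)}"

text \<open>
  The union in the composition is taken over all representatives; by \<open>equ_comp_class\<close> below it is
  the class of \<open>Comp X g f\<close> for any representatives \<open>g\<close>, \<open>f\<close>.
\<close>

definition Equ ::
    "('o, 'a) cat \<Rightarrow> ('o \<Rightarrow> 'u set) \<Rightarrow> ('a \<Rightarrow> 'u map) \<Rightarrow> (('o, 'u) equ_ob, ('o, 'a, 'u) equ_ar) cat"
  where
  "Equ X Uo Ua = (let Obs = {(x, r). x \<in> Ob X \<and> equiv (Uo x) r} in \<lparr>
     Ob = Obs,
     Ar = {(S, F, T). S \<in> Obs \<and> T \<in> Obs \<and> F \<in> equivariant X Ua S T // equ_rel X Ua S T},
     Dom = fst,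
     Cod = (\<lambda>p. snd (snd p)),
     Ide = (\<lambda>S. (S, equ_rel X Ua S S `` {Ide X (fst S)}, S)),
     Comp = (\<lambda>(_, G, W) (S, F, _).
       (S, \<Union>g\<in>G. \<Union>f\<in>F. equ_rel X Ua S W `` {Comp X g f}, W))\<rparr>)"

lemma equiv_equ_rel:
  assumes S: "equiv (Uo (fst S)) (snd S)" and T: "equiv (Uo (fst T)) (snd T)"
  shows "equiv (equivariant X Ua S T) (equ_rel X Ua S T)"
proof (rule equivI)
  show "equ_rel X Ua S T \<subseteq> equivariant X Ua S T \<times> equivariant X Ua S T"
    by (auto simp: equ_rel_def)
  show "refl_on (equivariant X Ua S T) (equ_rel X Ua S T)"
    by (auto simp: refl_on_def equ_rel_def equivariant_def)
  have symS: "(x', x) \<in> snd S" if "(x, x') \<in> snd S" for x x'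
    using S that by (meson equivE symD)
  have symT: "(x', x) \<in> snd T" if "(x, x') \<in> snd T" for x x'
    using T that by (meson equivE symD)
  show "sym (equ_rel X Ua S T)"
  proof (rule symI)
    fix f g assume fg: "(f, g) \<in> equ_rel X Ua S T"
    have "(fun_of (Ua g) x, fun_of (Ua f) x') \<in> snd T" if "(x, x') \<in> snd S" for x x'
      using fg symS[OF that] by (auto simp: equ_rel_def intro: symT)
    then show "(g, f) \<in> equ_rel X Ua S T" using fg by (auto simp: equ_rel_def)
  qed
  show "trans (equ_rel X Ua S T)"
  proof (rule transI)
    fix f g h assume fg: "(f, g) \<in> equ_rel X Ua S T" and gh: "(g, h) \<in> equ_rel X Ua S T"
    have "(fun_of (Ua f) x, fun_of (Ua h) x') \<in> snd T" if xx: "(x, x') \<in> snd S" for x x'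
    proof -
      have "(x', x') \<in> snd S"
        using S xx symS by (meson equivE transD)
      then have "(fun_of (Ua g) x', fun_of (Ua h) x') \<in> snd T"
        using gh by (auto simp: equ_rel_def)
      moreover have "(fun_of (Ua f) x, fun_of (Ua g) x') \<in> snd T"
        using fg xx by (auto simp: equ_rel_def)
      ultimately show ?thesis using T by (meson equivE transD)
    qed
    then show "(f, h) \<in> equ_rel X Ua S T"
      using fg gh by (auto simp: equ_rel_def)
  qed
qed

lemma fun_of_Comp:
  assumes "category X" "is_functor X Sets Uo Ua"
    and f: "f \<in> hom X a b" and g: "g \<in> hom X b c" and x: "x \<in> Uo a"
  shows "fun_of (Ua (Comp X g f)) x = fun_of (Ua g) (fun_of (Ua f) x)"
proof -
  have ob: "a \<in> Ob X" "b \<in> Ob X" "c \<in> Ob X"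
    using assms category.Dom_Ob category.Cod_Ob by (fastforce simp: hom_def)+
  then have "Ua (Comp X g f) = Comp Sets (Ua g) (Ua f)" "Ua f \<in> hom Sets (Uo a) (Uo b)"
    using assms by (auto simp: is_functor_def)
  then show ?thesis
    using x by (auto simp: Sets_def hom_def fun_of_def compose_def)
qed

lemma equ_rel_Comp:
  assumes X: "category X" "is_functor X Sets Uo Ua"
    and S: "equiv (Uo (fst S)) (snd S)"
    and f: "(f, f') \<in> equ_rel X Ua S T" and g: "(g, g') \<in> equ_rel X Ua T W"
  shows "(Comp X g f, Comp X g' f') \<in> equ_rel X Ua S W"
proof -
  have h: "f \<in> hom X (fst S) (fst T)" "f' \<in> hom X (fst S) (fst T)"
    "g \<in> hom X (fst T) (fst W)" "g' \<in> hom X (fst T) (fst W)"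
    using f g by (auto simp: equ_rel_def equivariant_def)
  have Comp: "Comp X k p \<in> hom X (fst S) (fst W)"
    if "p \<in> hom X (fst S) (fst T)" "k \<in> hom X (fst T) (fst W)" for k p
    using category.Comp_hom[OF X(1) that] .
  have dom: "x \<in> Uo (fst S) \<and> x' \<in> Uo (fst S)" if "(x, x') \<in> snd S" for x x'
    using S that by (auto dest: equiv_type)
  show ?thesis
    using f g h by (fastforce simp: equ_rel_def equivariant_def Comp dom fun_of_Comp[OF X])
qed

lemma equ_comp_class:
  assumes X: "category X" "is_functor X Sets Uo Ua"
    and S: "equiv (Uo (fst S)) (snd S)" and T: "equiv (Uo (fst T)) (snd T)"
    and W: "equiv (Uo (fst W)) (snd W)"
    and f: "f \<in> equivariant X Ua S T" and g: "g \<in> equivariant X Ua T W"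
  shows "Comp (Equ X Uo Ua) (T, equ_rel X Ua T W `` {g}, W) (S, equ_rel X Ua S T `` {f}, T) =
    (S, equ_rel X Ua S W `` {Comp X g f}, W)"
proof -
  note eqv = equiv_equ_rel[where X = X and Ua = Ua]
  have "equ_rel X Ua S W `` {Comp X g' f'} = equ_rel X Ua S W `` {Comp X g f}"
    if "g' \<in> equ_rel X Ua T W `` {g}" "f' \<in> equ_rel X Ua S T `` {f}" for g' f'
    using equiv_class_eq[OF eqv[OF S W] equ_rel_Comp[OF X S, of f f' T g g' W]] that by auto
  moreover have "f \<in> equ_rel X Ua S T `` {f}" "g \<in> equ_rel X Ua T W `` {g}"
    using f g equiv_class_self[OF eqv[OF S T]] equiv_class_self[OF eqv[OF T W]] by auto
  ultimately have "(\<Union>g'\<in>equ_rel X Ua T W `` {g}. \<Union>f'\<in>equ_rel X Ua S T `` {f}.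
      equ_rel X Ua S W `` {Comp X g' f'}) = equ_rel X Ua S W `` {Comp X g f}"
    by blast
  then show ?thesis by (simp add: Equ_def Let_def)
qed

lemma category_Equ:
  assumes X: "category X" "is_functor X Sets Uo Ua"
  shows "category (Equ X Uo Ua)"
proof -
  let ?E = "Equ X Uo Ua"
  let ?c = "\<lambda>S f T. (S, equ_rel X Ua S T `` {f}, T)"
  have Ob: "S \<in> Ob ?E \<longleftrightarrow> fst S \<in> Ob X \<and> equiv (Uo (fst S)) (snd S)" for S
    by (auto simp: Equ_def Let_def)
  have hom: "k \<in> hom ?E S T \<longleftrightarrow> S \<in> Ob ?E \<and> T \<in> Ob ?E \<and>
      (\<exists>f \<in> equivariant X Ua S T. k = ?c S f T)" for k S T
    by (auto simp: hom_def Equ_def Let_def quotient_def)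
  have Ide: "Ide ?E S = ?c S (Ide X (fst S)) S" for S
    by (simp add: Equ_def Let_def)
  have Comp: "Comp ?E (?c T g W) (?c S f T) = ?c S (Comp X g f) W"
    if "S \<in> Ob ?E" "T \<in> Ob ?E" "W \<in> Ob ?E" "f \<in> equivariant X Ua S T" "g \<in> equivariant X Ua T W"
    for S T W f g
    using that by (intro equ_comp_class[OF X]) (auto simp: Ob)
  have eq_Comp: "Comp X g f \<in> equivariant X Ua S W"
    if "S \<in> Ob ?E" "f \<in> equivariant X Ua S T" "g \<in> equivariant X Ua T W" for S T W f g
  proof -
    have "(f, f) \<in> equ_rel X Ua S T" "(g, g) \<in> equ_rel X Ua T W"
      using that by (auto simp: equ_rel_def equivariant_def)
    then have "(Comp X g f, Comp X g f) \<in> equ_rel X Ua S W"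
      using equ_rel_Comp[OF X] that(1) Ob by blast
    then show ?thesis by (simp add: equ_rel_def)
  qed
  have eq_Ide: "Ide X (fst S) \<in> equivariant X Ua S S" if S: "S \<in> Ob ?E" for S
  proof -
    have "Ua (Ide X (fst S)) = Ide Sets (Uo (fst S))"
      using X(2) S Ob by (auto simp: is_functor_def)
    moreover have "x \<in> Uo (fst S) \<and> x' \<in> Uo (fst S)" if "(x, x') \<in> snd S" for x x'
      using that S Ob by (blast dest: equiv_type)
    ultimately show ?thesis
      using category.Ide_hom[OF X(1)] S Ob
      by (fastforce simp: equivariant_def Sets_def fun_of_def)
  qed
  have X_hom: "f \<in> hom X (fst S) (fst T)" if "f \<in> equivariant X Ua S T" for f S T
    using that by (simp add: equivariant_def)
  show ?thesis
  proof
    fix f assume "f \<in> Ar ?E"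
    then show "Dom ?E f \<in> Ob ?E" "Cod ?E f \<in> Ob ?E" by (auto simp: Equ_def Let_def)
  next
    fix a assume "a \<in> Ob ?E"
    then show "Ide ?E a \<in> hom ?E a a" using eq_Ide unfolding hom Ide by blast
  next
    fix f g a b c assume "f \<in> hom ?E a b" "g \<in> hom ?E b c"
    then show "Comp ?E g f \<in> hom ?E a c"
      using Comp eq_Comp unfolding hom by blast
  next
    fix f a b assume "f \<in> hom ?E a b"
    then obtain k where ob: "a \<in> Ob ?E" "b \<in> Ob ?E"
      and k: "k \<in> equivariant X Ua a b" "f = ?c a k b"
      by (auto simp: hom)
    show "Comp ?E f (Ide ?E a) = f" "Comp ?E (Ide ?E b) f = f"
      unfolding Ide k(2)
      using Comp[OF ob(1,1,2) eq_Ide[OF ob(1)] k(1)] Comp[OF ob(1,2,2) k(1) eq_Ide[OF ob(2)]]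
        category.Comp_Ide[OF X(1) X_hom[OF k(1)]] category.Ide_Comp[OF X(1) X_hom[OF k(1)]]
      by simp_all
  next
    fix f g h a b c d
    assume f: "f \<in> hom ?E a b" and g: "g \<in> hom ?E b c" and h: "h \<in> hom ?E c d"
    obtain f' where f': "a \<in> Ob ?E" "b \<in> Ob ?E" "f' \<in> equivariant X Ua a b" "f = ?c a f' b"
      using f by (auto simp: hom)
    obtain g' where g': "c \<in> Ob ?E" "g' \<in> equivariant X Ua b c" "g = ?c b g' c"
      using g by (auto simp: hom)
    obtain h' where h': "d \<in> Ob ?E" "h' \<in> equivariant X Ua c d" "h = ?c c h' d"
      using h by (auto simp: hom)
    have "Comp ?E h (Comp ?E g f) = ?c a (Comp X h' (Comp X g' f')) d"
      unfolding f'(4) g'(3) h'(3)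
      using f' g' h' by (simp only: Comp eq_Comp)
    moreover have "Comp ?E (Comp ?E h g) f = ?c a (Comp X (Comp X h' g') f') d"
      unfolding f'(4) g'(3) h'(3)
      using f' g' h' by (simp only: Comp eq_Comp)
    moreover have "Comp X h' (Comp X g' f') = Comp X (Comp X h' g') f'"
      using category.Comp_assoc[OF X(1) X_hom[OF f'(3)] X_hom[OF g'(2)] X_hom[OF h'(2)]] .
    ultimately show "Comp ?E h (Comp ?E g f) = Comp ?E (Comp ?E h g) f" by simp
  qed
qed

end

theory Submission
  imports Defs
begin

text \<open>
  An equilogical object is a set with two pieces of decoration: an \<open>X\<close>-structure and an
  equivalence relation. An arrow is a function that lifts to \<open>X\<close> and preserves the relations,
  taken up to pointwise equivalence in the target. The proof therefore works with functions:
  \<open>admissible\<close> says that a function lifts to an arrow of \<open>X\<close>, \<open>tracks\<close> adds that it respects the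
  relations, and \<open>hom_Equ\<close>, \<open>arrow_eq_iff\<close> and \<open>Comp_arrow\<close> translate arrows of the category of
  equilogical objects, their equality and their composition into statements about such functions.
  The functor to sets being topological enters only through \<open>initial_lift\<close> and \<open>final_lift\<close>: every
  family of functions out of, or into, a small set induces a best structure on that set.

  The limit of a diagram is computed as if its arrows commuted only up to the equivalence relations.
  Choose a function \<open>d k\<close> for every arrow \<open>k\<close> of the diagram, and take all tuples \<open>x\<close> such that
  \<open>d k (x (Dom J k))\<close> is equivalent (instead of equal) to \<open>x (Cod J k)\<close>, with the initial structure
  for the projections and the componentwise equivalence relation. Functions that represent a cone
  assemble, value by value, to a function into this set of tuples. Dually, the colimit is the
  disjoint union of the underlying sets with the final structure, and the diagram is glued by the
  equivalence relation alone: it is generated by the given relations and by the pairs of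
  \<open>d k u\<close> and \<open>u\<close>. No quotient of the underlying object of \<open>X\<close> is formed.

  The same recipe shows what equalizers and coequalizers look like. Every parallel pair out of \<open>B\<close>
  has an equalizer that is a subset of the underlying set of \<open>B\<close> with the initial structure, and
  every parallel pair into \<open>B\<close> has a coequalizer that is \<open>B\<close> itself with a coarser equivalence
  relation. As equalizers and coequalizers are unique up to isomorphism, there are at most as many
  regular subobjects as subsets, and at most as many regular quotients as binary relations, on the
  underlying set of \<open>B\<close>; these form a small set because the universe is closed under power sets
  and products.
\<close>

section \<open>Small sets\<close>

lemma small_lepoll: "small u A \<Longrightarrow> B \<lesssim> A \<Longrightarrow> small u B"
  by (auto simp: small_def intro: lesspoll_trans1)

lemma small_image: "small u A \<Longrightarrow> small u (f ` A)"
  by (erule small_lepoll) (rule image_lepoll)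

lemma small_subset: "small u A \<Longrightarrow> B \<subseteq> A \<Longrightarrow> small u B"
  by (erule small_lepoll) (rule subset_imp_lepoll)

text \<open>
  A small set of any type can be coded by elements of \<open>'u\<close>. This turns sets of tuples and
  disjoint unions into underlying sets of objects.
\<close>

lemma small_embeds:
  assumes "small TYPE('u) A"
  obtains e :: "'b \<Rightarrow> 'u" where "inj_on e A"
  using assms by (auto simp: small_def lesspoll_def lepoll_def)

lemma small_Pow:
  assumes u: "universe TYPE('u)" and A: "small TYPE('u) A"
  shows "small TYPE('u) (Pow A)"
proof -
  obtain e :: "_ \<Rightarrow> 'u" where e: "inj_on e A" using small_embeds[OF A] .
  have "small TYPE('u) (Pow (e ` A))"
    using u small_image[OF A] by (auto simp: universe_def)
  moreover have "Pow A \<lesssim> Pow (e ` A)"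
    unfolding lepoll_def using e inj_on_image_Pow
    by (metis image_Pow_surj subset_refl)
  ultimately show ?thesis by (rule small_lepoll)
qed

text \<open>
  A finite type with \<open>n + 1\<close> elements has a small subset with \<open>n\<close> elements, whose \<open>2 ^ n\<close> subsets are
  too many.
\<close>

lemma universe_infinite:
  assumes u: "universe TYPE('u)"
  shows "infinite (UNIV :: 'u set)"
proof
  assume fin: "finite (UNIV :: 'u set)"
  obtain a :: 'u where "a \<in> UNIV" by simp
  let ?A = "UNIV - {a}"
  have card: "card (UNIV :: 'u set) = Suc (card ?A)"
    using card.remove[OF fin \<open>a \<in> UNIV\<close>] .
  have "\<not> (UNIV :: 'u set) \<lesssim> ?A"
    using fin card by (simp add: lepoll_iff_card_le)
  then have "small TYPE('u) ?A"
    unfolding small_def lesspoll_def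
    by (meson eqpoll_imp_lepoll eqpoll_sym subset_imp_lepoll subset_UNIV)
  then have "small TYPE('u) (Pow ?A)" using small_Pow[OF u] by blast
  then have "Pow ?A \<lesssim> (UNIV :: 'u set)" by (simp add: small_def lesspoll_def)
  then have "2 ^ card ?A \<le> card (UNIV :: 'u set)"
    using fin by (simp add: lepoll_iff_card_le card_Pow)
  moreover have "\<not> Pow ?A \<approx> (UNIV :: 'u set)"
    using \<open>small TYPE('u) (Pow ?A)\<close> by (simp add: small_def lesspoll_def)
  then have "2 ^ card ?A \<noteq> card (UNIV :: 'u set)"
    using fin by (simp add: eqpoll_iff_card card_Pow)
  ultimately show False
    using card less_exp[of "card ?A"] by linarith
qed

text \<open>
  Closure under unions speaks of subsets of \<open>'u\<close> only, so the pairs are first coded by elements of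
  \<open>'u\<close>; this is possible because an infinite type is equipotent to its square.
\<close>

lemma small_Sigma:
  fixes I :: "'u set" and F :: "'u \<Rightarrow> 'u set"
  assumes u: "universe TYPE('u)" and I: "small TYPE('u) I"
    and F: "\<And>i. i \<in> I \<Longrightarrow> small TYPE('u) (F i)"
  shows "small TYPE('u) (Sigma I F)"
proof -
  have "(UNIV :: 'u set) \<times> (UNIV :: 'u set) \<lesssim> (UNIV :: 'u set)"
    using card_of_Times_same_infinite[OF universe_infinite[OF u]]
    by (simp add: eqpoll_imp_lepoll eqpoll_iff_card_of_ordIso)
  then obtain p :: "'u \<times> 'u \<Rightarrow> 'u" where p: "inj p"
    by (auto simp: lepoll_def)
  have "p ` Sigma I F = (\<Union>i\<in>I. (\<lambda>x. p (i, x)) ` F i)" by auto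
  then have small: "small TYPE('u) (p ` Sigma I F)"
    using u[unfolded universe_def, THEN conjunct2, rule_format, of I "\<lambda>i. (\<lambda>x. p (i, x)) ` F i"]
      I small_image[OF F] by metis
  have "Sigma I F \<lesssim> p ` Sigma I F"
    unfolding lepoll_def using inj_on_subset[OF p subset_UNIV] by blast
  then show ?thesis using small_lepoll[OF small] by blast
qed

text \<open>
  A dependent function is determined by its graph, a subset of the disjoint sum.
\<close>

lemma small_PiE:
  fixes I :: "'u set" and F :: "'u \<Rightarrow> 'u set"
  assumes u: "universe TYPE('u)" and I: "small TYPE('u) I"
    and F: "\<And>i. i \<in> I \<Longrightarrow> small TYPE('u) (F i)"
  shows "small TYPE('u) (PiE I F)"
proof -
  let ?graph = "\<lambda>f. (\<lambda>i. (i, f i)) ` I"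
  have "inj_on ?graph (PiE I F)"
  proof (rule inj_onI)
    fix f g assume fg: "f \<in> PiE I F" "g \<in> PiE I F" and eq: "?graph f = ?graph g"
    have "f i = g i" if "i \<in> I" for i
      using that eq by (metis (no_types, lifting) imageE imageI prod.inject)
    then show "f = g" using fg by (meson PiE_ext)
  qed
  moreover have "?graph ` PiE I F \<subseteq> Pow (Sigma I F)" by auto
  ultimately have "PiE I F \<lesssim> Pow (Sigma I F)" unfolding lepoll_def by blast
  moreover have "small TYPE('u) (Sigma I F)" using small_Sigma[OF u I F] .
  ultimately show ?thesis using small_lepoll[OF small_Pow[OF u]] by blast
qed


section \<open>Counting regular subobjects and quotients of an arbitrary category\<close>

text \<open>
  Symmetry and transitivity are enough for the class of an arrow to be the class of any arrow that
  is related to it.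
\<close>

lemma (in category) iso_over_sym_trans: "sym (iso_over C b)" "trans (iso_over C b)"
proof -
  show "sym (iso_over C b)"
  proof (rule symI)
    fix m n assume "(m, n) \<in> iso_over C b"
    then obtain i where mn: "m \<in> Ar C" "n \<in> Ar C" "Cod C m = b" "Cod C n = b"
      and i: "i \<in> hom C (Dom C m) (Dom C n)" "iso C i" "Comp C n i = m"
      by (auto simp: iso_over_def)
    then obtain j where j: "j \<in> hom C (Dom C n) (Dom C m)"
      "Comp C j i = Ide C (Dom C m)" "Comp C i j = Ide C (Dom C n)"
      by (auto simp: iso_def hom_def)
    have n: "n \<in> hom C (Dom C n) b" using mn by (auto simp: hom_def)
    have "Comp C m j = n"
      using Comp_assoc[OF j(1) i(1) n] i(3) j(3) Comp_Ide[OF n] by simp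
    moreover have "iso C j" using i(1) j by (auto simp: iso_def hom_def)
    ultimately show "(n, m) \<in> iso_over C b" using mn j(1) by (auto simp: iso_over_def)
  qed
  show "trans (iso_over C b)"
  proof (rule transI)
    fix m n p assume "(m, n) \<in> iso_over C b" "(n, p) \<in> iso_over C b"
    then obtain i k where ar: "m \<in> Ar C" "n \<in> Ar C" "p \<in> Ar C" "Cod C m = b" "Cod C n = b" "Cod C p = b"
      and i: "i \<in> hom C (Dom C m) (Dom C n)" "iso C i" "Comp C n i = m"
      and k: "k \<in> hom C (Dom C n) (Dom C p)" "iso C k" "Comp C p k = n"
      by (auto simp: iso_over_def)
    obtain i' where i': "i' \<in> hom C (Dom C n) (Dom C m)"
      "Comp C i' i = Ide C (Dom C m)" "Comp C i i' = Ide C (Dom C n)"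
      using i by (auto simp: iso_def hom_def)
    obtain k' where k': "k' \<in> hom C (Dom C p) (Dom C n)"
      "Comp C k' k = Ide C (Dom C n)" "Comp C k k' = Ide C (Dom C p)"
      using k by (auto simp: iso_def hom_def)
    have p: "p \<in> hom C (Dom C p) b" using ar by (auto simp: hom_def)
    have ki: "Comp C k i \<in> hom C (Dom C m) (Dom C p)" using Comp_hom[OF i(1) k(1)] .
    have "Comp C (Comp C i' k') (Comp C k i) = Comp C i' (Comp C (Comp C k' k) i)"
      using Comp_assoc[OF ki k'(1) i'(1)] Comp_assoc[OF i(1) k(1) k'(1)] by simp
    then have 1: "Comp C (Comp C i' k') (Comp C k i) = Ide C (Dom C m)"
      using k'(2) i'(2) Ide_Comp[OF i(1)] by simp
    have "Comp C (Comp C k i) (Comp C i' k') = Comp C k (Comp C (Comp C i i') k')"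
      using Comp_assoc[OF Comp_hom[OF k'(1) i'(1)] i(1) k(1)] Comp_assoc[OF k'(1) i'(1) i(1)] by simp
    then have 2: "Comp C (Comp C k i) (Comp C i' k') = Ide C (Dom C p)"
      using k'(3) i'(3) Ide_Comp[OF k'(1)] by simp
    have "iso C (Comp C k i)"
      using ki Comp_hom[OF k'(1) i'(1)] 1 2 by (auto simp: iso_def hom_def)
    moreover have "Comp C p (Comp C k i) = m"
      using Comp_assoc[OF i(1) k(1) p] k(3) i(3) by simp
    ultimately show "(m, p) \<in> iso_over C b" using ar ki by (auto simp: iso_over_def)
  qed
qed

text \<open>
  The opposite category reduces the count of regular quotients to the count of regular subobjects.
\<close>

definition opposite :: "('o, 'a) cat \<Rightarrow> ('o, 'a) cat" where
  "opposite C = \<lparr>Ob = Ob C, Ar = Ar C, Dom = Cod C, Cod = Dom C, Ide = Ide C,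
     Comp = (\<lambda>g f. Comp C f g)\<rparr>"

lemma opposite_simps [simp]:
  "Ob (opposite C) = Ob C" "Ar (opposite C) = Ar C" "Dom (opposite C) = Cod C"
  "Cod (opposite C) = Dom C" "Ide (opposite C) = Ide C" "Comp (opposite C) g f = Comp C f g"
  "hom (opposite C) a b = hom C b a"
  by (auto simp: opposite_def hom_def)

lemma (in category) category_opposite: "category (opposite C)"
  by unfold_locales
    (simp_all add: Dom_Ob Cod_Ob Ide_hom Comp_hom Comp_Ide Ide_Comp, metis Comp_assoc)

lemma iso_opposite: "iso (opposite C) i \<longleftrightarrow> iso C i"
  by (auto simp: iso_def)

lemma is_coequalizer_opposite: "is_equalizer (opposite C) f g e \<longleftrightarrow> is_coequalizer C f g e"
  by (simp add: is_equalizer_def is_coequalizer_def)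

lemma equalizer_factor:
  assumes "is_equalizer C f g m" "z \<in> Ob C" "h \<in> hom C z (Cod C m)" "Comp C f h = Comp C g h"
  shows "\<exists>!k. k \<in> hom C z (Dom C m) \<and> Comp C m k = h"
  using assms unfolding is_equalizer_def by blast

lemma (in category) equalizers_iso_over:
  assumes em: "is_equalizer C f g m" and en: "is_equalizer C f g n"
    and cod: "Cod C m = b" "Cod C n = b"
  shows "(m, n) \<in> iso_over C b"
proof -
  have ar: "m \<in> Ar C" "n \<in> Ar C" and eq: "Comp C f m = Comp C g m" "Comp C f n = Comp C g n"
    using em en by (simp_all add: is_equalizer_def)
  have m: "m \<in> hom C (Dom C m) b" and n: "n \<in> hom C (Dom C n) b"
    using ar cod by (simp_all add: hom_def)
  have ob: "Dom C m \<in> Ob C" "Dom C n \<in> Ob C" using ar Dom_Ob by blast+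
  note factor_m = equalizer_factor[OF em, unfolded cod]
    and factor_n = equalizer_factor[OF en, unfolded cod]
  obtain i where i: "i \<in> hom C (Dom C m) (Dom C n)" "Comp C n i = m"
    using factor_n[OF ob(1) m eq(1)] by (elim ex1E) blast
  obtain j where j: "j \<in> hom C (Dom C n) (Dom C m)" "Comp C m j = n"
    using factor_m[OF ob(2) n eq(2)] by (elim ex1E) blast
  have "Comp C m (Comp C j i) = m" using Comp_assoc[OF i(1) j(1) m] i j by simp
  then have ji: "Comp C j i = Ide C (Dom C m)"
    using factor_m[OF ob(1) m eq(1)] Comp_hom[OF i(1) j(1)] Ide_hom[OF ob(1)] Comp_Ide[OF m]
    by (elim ex1E) metis
  have "Comp C n (Comp C i j) = n" using Comp_assoc[OF j(1) i(1) n] i j by simp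
  then have ij: "Comp C i j = Ide C (Dom C n)"
    using factor_n[OF ob(2) n eq(2)] Comp_hom[OF j(1) i(1)] Ide_hom[OF ob(2)] Comp_Ide[OF n]
    by (elim ex1E) metis
  have "iso C i" using i j ij ji by (auto simp: iso_def hom_def)
  then show ?thesis using i ar cod by (auto simp: iso_over_def)
qed

lemma small_quotient_if_covered:
  assumes "sym r" "trans r" "small u P" "\<And>m. m \<in> M \<Longrightarrow> \<exists>p\<in>P. (m, c p) \<in> r"
  shows "small u (M // r)"
proof -
  have "M // r \<subseteq> (\<lambda>p. r `` {c p}) ` P"
  proof
    fix K assume "K \<in> M // r"
    then obtain m where m: "m \<in> M" "K = r `` {m}" by (auto simp: quotient_def)
    then obtain p where p: "p \<in> P" "(m, c p) \<in> r" using assms(4) by blast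
    have "r `` {m} = r `` {c p}" using p(2) assms(1,2) by (auto dest: symD transD)
    then show "K \<in> (\<lambda>p. r `` {c p}) ` P" using m p by blast
  qed
  then show ?thesis using assms(3) small_image small_subset by metis
qed

text \<open>
  Isomorphic arrows represent the same regular subobject, so it suffices to find one equalizer of each
  parallel pair within a small family \<open>c\<close>.
\<close>

lemma (in category) small_regular_subobjects:
  assumes P: "small u P"
    and c: "\<And>d f g. d \<in> Ob C \<Longrightarrow> f \<in> hom C b d \<Longrightarrow> g \<in> hom C b d \<Longrightarrow>
      \<exists>p\<in>P. Cod C (c p) = b \<and> is_equalizer C f g (c p)"
  shows "small u (regular_monos_into C b // iso_over C b)"
proof (rule small_quotient_if_covered[OF iso_over_sym_trans P, where c = c])
  fix m assume "m \<in> regular_monos_into C b"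
  then obtain d f g where "d \<in> Ob C" "f \<in> hom C b d" "g \<in> hom C b d"
    "is_equalizer C f g m" "Cod C m = b"
    by (auto simp: regular_monos_into_def regular_mono_def)
  then show "\<exists>p\<in>P. (m, c p) \<in> iso_over C b" using c equalizers_iso_over by blast
qed

lemma regular_monos_into_opposite: "regular_monos_into (opposite C) b = regular_epis_from C b"
  by (simp add: regular_monos_into_def regular_epis_from_def regular_mono_def regular_epi_def
      is_coequalizer_opposite)

lemma (in category) iso_over_opposite: "iso_over (opposite C) b = iso_under C b"
proof -
  \<comment> \<open>Reversing an arrow turns the comparison isomorphism around; symmetry absorbs this.\<close>
  have "sym (iso_over (opposite C) b)"
    using category.iso_over_sym_trans(1)[OF category_opposite] .
  then have "iso_over (opposite C) b = (iso_over (opposite C) b)\<inverse>"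
    by (simp add: sym_conv_converse_eq)
  then show ?thesis
    by (auto simp: iso_over_def iso_under_def iso_opposite)
qed

lemma (in category) small_regular_quotients:
  assumes P: "small u P"
    and c: "\<And>d f g. d \<in> Ob C \<Longrightarrow> f \<in> hom C d b \<Longrightarrow> g \<in> hom C d b \<Longrightarrow>
      \<exists>p\<in>P. Dom C (c p) = b \<and> is_coequalizer C f g (c p)"
  shows "small u (regular_epis_from C b // iso_under C b)"
  using category.small_regular_subobjects[OF category_opposite P, of b c] c
  by (simp add: is_coequalizer_opposite regular_monos_into_opposite iso_over_opposite)


section \<open>Generated equivalence relations\<close>

text \<open>
  Defined from above, since minimality is what colimits need: a function respects the relation once
  it identifies the generating pairs.
\<close>

definition generated_equiv :: "'b set \<Rightarrow> 'b rel \<Rightarrow> 'b rel" where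
  "generated_equiv A G = {(x, y) \<in> A \<times> A. \<forall>Q. equiv A Q \<and> G \<subseteq> Q \<longrightarrow> (x, y) \<in> Q}"

lemma equiv_generated_equiv: "equiv A (generated_equiv A G)"
proof (rule equivI)
  show "generated_equiv A G \<subseteq> A \<times> A" by (auto simp: generated_equiv_def)
  show "refl_on A (generated_equiv A G)"
    by (auto simp: refl_on_def generated_equiv_def equiv_def)
  show "sym (generated_equiv A G)"
    unfolding generated_equiv_def equiv_def sym_def by blast
  show "trans (generated_equiv A G)"
    unfolding generated_equiv_def equiv_def trans_def by blast
qed

lemma generated_equiv_contains: "G \<subseteq> A \<times> A \<Longrightarrow> G \<subseteq> generated_equiv A G"
  by (auto simp: generated_equiv_def)

lemma generated_equiv_least: "equiv A Q \<Longrightarrow> G \<subseteq> Q \<Longrightarrow> generated_equiv A G \<subseteq> Q"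
  by (auto simp: generated_equiv_def)


section \<open>Initial and final structures\<close>

locale topological_over_sets = category X
  for X :: "('o, 'a) cat" +
  fixes Uo :: "'o \<Rightarrow> 'u set" and Ua :: "'a \<Rightarrow> 'u map"
  assumes topological: "topological X Sets Uo Ua"
begin

lemma forgetful_functor: "is_functor X Sets Uo Ua"
  using topological by (simp add: topological_def)

lemma small_Uo: "x \<in> Ob X \<Longrightarrow> small TYPE('u) (Uo x)"
  using forgetful_functor by (auto simp: is_functor_def Sets_def)

text \<open>
  Values are compared on \<open>Uo x\<close> only, so that functions can be given by plain \<open>\<lambda>\<close>-terms and composed
  without restricting them.
\<close>

definition admissible :: "'o \<Rightarrow> 'o \<Rightarrow> ('u \<Rightarrow> 'u) \<Rightarrow> bool" where
  "admissible x y f \<longleftrightarrow> (\<exists>\<phi>\<in>hom X x y. \<forall>u\<in>Uo x. fun_of (Ua \<phi>) u = f u)"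

lemma Ua_hom:
  assumes "\<phi> \<in> hom X x y"
  shows "Ua \<phi> \<in> hom Sets (Uo x) (Uo y)"
  using assms forgetful_functor Dom_Ob Cod_Ob unfolding is_functor_def hom_def[of X] by blast

lemma fun_of_Ua: "\<phi> \<in> hom X x y \<Longrightarrow> u \<in> Uo x \<Longrightarrow> fun_of (Ua \<phi>) u \<in> Uo y"
  using Ua_hom by (fastforce simp: hom_def Sets_def fun_of_def)

lemma admissible_maps: "admissible x y f \<Longrightarrow> u \<in> Uo x \<Longrightarrow> f u \<in> Uo y"
  using fun_of_Ua by (fastforce simp: admissible_def)

lemma admissible_cong:
  "(\<And>u. u \<in> Uo x \<Longrightarrow> f u = g u) \<Longrightarrow> admissible x y f \<longleftrightarrow> admissible x y g"
  by (simp add: admissible_def)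

lemma admissible_comp:
  assumes "admissible x y f" "admissible y z g"
  shows "admissible x z (\<lambda>u. g (f u))"
proof -
  obtain \<phi> \<psi> where *: "\<phi> \<in> hom X x y" "\<psi> \<in> hom X y z"
    "\<forall>u\<in>Uo x. fun_of (Ua \<phi>) u = f u" "\<forall>u\<in>Uo y. fun_of (Ua \<psi>) u = g u"
    using assms by (auto simp: admissible_def)
  have "fun_of (Ua (Comp X \<psi> \<phi>)) u = g (f u)" if "u \<in> Uo x" for u
    using fun_of_Comp[OF category_axioms forgetful_functor *(1,2) that] * that admissible_maps assms(1)
    by simp
  then show ?thesis using Comp_hom[OF *(1,2)] by (auto simp: admissible_def)
qed

lemma Sets_hom_iff: "k \<in> hom Sets A B \<longleftrightarrow>
    small TYPE('u) A \<and> small TYPE('u) B \<and> (\<exists>\<kappa>\<in>A \<rightarrow>\<^sub>E B. k = (A, \<kappa>, B))" for A B :: "'u set"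
  by (auto simp: Sets_def hom_def)

lemma restricted_map_hom:
  assumes "small TYPE('u) A" "y \<in> Ob X" "g \<in> A \<rightarrow> Uo y"
  shows "(A, restrict g A, Uo y) \<in> hom Sets A (Uo y)"
  using assms small_Uo by (auto simp: Sets_hom_iff)

lemma initial_lifting:
  fixes I :: "'a set"
  assumes A: "small TYPE('u) A"
    and S: "\<And>i. i \<in> I \<Longrightarrow> y i \<in> Ob X \<and> g i \<in> A \<rightarrow> Uo (y i)"
  obtains a \<phi> where "initial_source X Sets Uo Ua a I y \<phi>" "Uo a = A"
    "\<And>i. i \<in> I \<Longrightarrow> Ua (\<phi> i) = (A, restrict (g i) A, Uo (y i))"
proof -
  have "A \<in> Ob Sets" using A by (simp add: Sets_def)
  moreover have "\<forall>i\<in>I. y i \<in> Ob X \<and> (A, restrict (g i) A, Uo (y i)) \<in> hom Sets A (Uo (y i))"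
    using S restricted_map_hom[OF A] by blast
  ultimately have "unique_initial_lifting X Sets Uo Ua A I y (\<lambda>i. (A, restrict (g i) A, Uo (y i)))"
    using topological[unfolded topological_def, THEN conjunct2, THEN bspec] by simp
  then obtain a \<phi> where "initial_source X Sets Uo Ua a I y \<phi>" "Uo a = A"
    "\<forall>i\<in>I. Ua (\<phi> i) = (A, restrict (g i) A, Uo (y i))"
    unfolding unique_initial_lifting_def by (elim ex1E case_prodE conjE)
  then show thesis using that by simp
qed

text \<open>
  The best structure for a set \<open>S\<close> of functions out of \<open>A\<close>. Liftings are granted for sources indexed
  by arrows of \<open>X\<close>, whereas \<open>S\<close> consists of pairs. The source to lift is therefore indexed by those
  arrows whose domain lives on \<open>A\<close> and whose underlying function belongs to \<open>S\<close>. Each member of \<open>S\<close>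
  occurs in it: the lifting of the constant source with this member alone provides such an arrow.
\<close>

lemma initial_lift:
  assumes A: "small TYPE('u) A"
    and S: "\<And>y g. (y, g) \<in> S \<Longrightarrow> y \<in> Ob X \<and> g \<in> A \<rightarrow> Uo y"
  obtains a where "a \<in> Ob X" "Uo a = A" "\<And>y g. (y, g) \<in> S \<Longrightarrow> admissible a y g"
    "\<And>z h. z \<in> Ob X \<Longrightarrow> h \<in> Uo z \<rightarrow> A \<Longrightarrow> (\<And>y g. (y, g) \<in> S \<Longrightarrow> admissible z y (\<lambda>u. g (h u))) \<Longrightarrow>
      admissible z a h"
proof -
  define I where "I = {\<phi> \<in> Ar X. Uo (Dom X \<phi>) = A \<and>
    (\<exists>(y, g)\<in>S. y = Cod X \<phi> \<and> (\<forall>u\<in>A. fun_of (Ua \<phi>) u = g u))}"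
  have I: "Cod X \<phi> \<in> Ob X \<and> fun_of (Ua \<phi>) \<in> A \<rightarrow> Uo (Cod X \<phi>)" if "\<phi> \<in> I" for \<phi>
    using that Cod_Ob fun_of_Ua[of \<phi> "Dom X \<phi>" "Cod X \<phi>"] by (auto simp: I_def hom_def)
  obtain a \<psi> where a: "initial_source X Sets Uo Ua a I (Cod X) \<psi>" "Uo a = A"
    "\<And>\<phi>. \<phi> \<in> I \<Longrightarrow> Ua (\<psi> \<phi>) = (A, restrict (fun_of (Ua \<phi>)) A, Uo (Cod X \<phi>))"
    by (rule initial_lifting[of A I "Cod X" "\<lambda>\<phi>. fun_of (Ua \<phi>)", OF A]) (erule I, rule that)
  have \<psi>: "a \<in> Ob X" "\<And>\<phi>. \<phi> \<in> I \<Longrightarrow> \<psi> \<phi> \<in> hom X a (Cod X \<phi>)"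
    using a(1) by (auto simp: initial_source_def)
  show thesis
  proof (rule that[OF \<psi>(1) a(2)])
    fix y g assume yg: "(y, g) \<in> S"
    \<comment> \<open>An arrow over the given function, so that the function is a member of the source.\<close>
    obtain b \<chi> where b: "initial_source X Sets Uo Ua b (UNIV :: 'a set) (\<lambda>_. y) \<chi>" "Uo b = A"
      "\<And>i. Ua (\<chi> i) = (A, restrict g A, Uo y)"
      using initial_lifting[OF A, of UNIV "\<lambda>_. y" "\<lambda>_. g"] S[OF yg] by auto
    let ?\<phi> = "\<chi> undefined"
    have "?\<phi> \<in> hom X b y" using b(1) by (simp add: initial_source_def)
    then have "?\<phi> \<in> I" "Cod X ?\<phi> = y"
      using yg b(2,3) by (auto simp: I_def hom_def fun_of_def intro!: bexI[of _ "(y, g)"])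
    then have "\<psi> ?\<phi> \<in> hom X a y" "\<forall>u\<in>Uo a. fun_of (Ua (\<psi> ?\<phi>)) u = g u"
      using \<psi>(2)[of ?\<phi>] a(2) a(3)[of ?\<phi>] b(3) by (simp_all add: fun_of_def)
    then show "admissible a y g" by (auto simp: admissible_def)
  next
    fix z h assume z: "z \<in> Ob X" and h: "h \<in> Uo z \<rightarrow> A"
      and S': "\<And>y g. (y, g) \<in> S \<Longrightarrow> admissible z y (\<lambda>u. g (h u))"
    let ?h = "(Uo z, restrict h (Uo z), A)"
    have "\<exists>\<gamma>. \<gamma> \<in> hom X z (Cod X \<phi>) \<and> Ua \<gamma> = Comp Sets (Ua (\<psi> \<phi>)) ?h" if \<phi>: "\<phi> \<in> I" for \<phi>
    proof -
      obtain g where g: "(Cod X \<phi>, g) \<in> S" "\<forall>u\<in>A. fun_of (Ua \<phi>) u = g u"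
        using \<phi> by (auto simp: I_def)
      obtain \<gamma> where \<gamma>: "\<gamma> \<in> hom X z (Cod X \<phi>)" "\<forall>u\<in>Uo z. fun_of (Ua \<gamma>) u = g (h u)"
        using S'[OF g(1)] by (auto simp: admissible_def)
      obtain \<kappa> where \<kappa>: "\<kappa> \<in> Uo z \<rightarrow>\<^sub>E Uo (Cod X \<phi>)" "Ua \<gamma> = (Uo z, \<kappa>, Uo (Cod X \<phi>))"
        using Ua_hom[OF \<gamma>(1)] by (auto simp: Sets_hom_iff)
      have "\<kappa> u = compose (Uo z) (restrict (fun_of (Ua \<phi>)) A) (restrict h (Uo z)) u" for u
        using \<kappa> \<gamma>(2) g(2) h by (auto simp: compose_def fun_of_def)
      then have "Ua \<gamma> = Comp Sets (Ua (\<psi> \<phi>)) ?h"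
        using \<kappa>(2) a(3)[OF \<phi>] by (auto simp: Sets_def fun_of_def)
      then show ?thesis using \<gamma>(1) by blast
    qed
    then obtain \<gamma> where \<gamma>: "\<forall>\<phi>\<in>I. \<gamma> \<phi> \<in> hom X z (Cod X \<phi>) \<and> Ua (\<gamma> \<phi>) = Comp Sets (Ua (\<psi> \<phi>)) ?h"
      by metis
    have "?h \<in> hom Sets (Uo z) (Uo a)"
      using z h A small_Uo a(2) by (auto simp: Sets_hom_iff)
    then obtain k where "k \<in> hom X z a" "Ua k = ?h"
      using a(1) z \<gamma> unfolding initial_source_def by blast
    then show "admissible z a h"
      unfolding admissible_def fun_of_def by (intro bexI[of _ k]) simp_all
  qed
qed

text \<open>
  Final structures come from initial ones: equip \<open>A\<close> with the initial structure for all functions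
  \<open>h\<close> out of \<open>A\<close> whose composites with the members of \<open>S\<close> are admissible. Each member of \<open>S\<close> is then
  admissible because its composites with these \<open>h\<close> are.
\<close>

lemma final_lift:
  assumes A: "small TYPE('u) A"
    and S: "\<And>y g. (y, g) \<in> S \<Longrightarrow> y \<in> Ob X \<and> g \<in> Uo y \<rightarrow> A"
  obtains a where "a \<in> Ob X" "Uo a = A" "\<And>y g. (y, g) \<in> S \<Longrightarrow> admissible y a g"
    "\<And>z h. z \<in> Ob X \<Longrightarrow> h \<in> A \<rightarrow> Uo z \<Longrightarrow> (\<And>y g. (y, g) \<in> S \<Longrightarrow> admissible y z (\<lambda>u. h (g u))) \<Longrightarrow>
      admissible a z h"
proof -
  define H where "H = {(z, h). z \<in> Ob X \<and> h \<in> A \<rightarrow> Uo z \<and>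
    (\<forall>(y, g)\<in>S. admissible y z (\<lambda>u. h (g u)))}"
  have "z \<in> Ob X \<and> h \<in> A \<rightarrow> Uo z" if "(z, h) \<in> H" for z h
    using that by (simp add: H_def)
  then obtain a where a: "a \<in> Ob X" "Uo a = A" "\<And>z h. (z, h) \<in> H \<Longrightarrow> admissible a z h"
    "\<And>y g. y \<in> Ob X \<Longrightarrow> g \<in> Uo y \<rightarrow> A \<Longrightarrow> (\<And>z h. (z, h) \<in> H \<Longrightarrow> admissible y z (\<lambda>u. h (g u))) \<Longrightarrow>
      admissible y a g"
    by (rule initial_lift[OF A, of H]) blast+
  show thesis
  proof (rule that[OF a(1,2)])
    show "admissible y a g" if "(y, g) \<in> S" for y g
      by (rule a(4)) (use that S in \<open>auto simp: H_def\<close>)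
    show "admissible a z h" if "z \<in> Ob X" "h \<in> A \<rightarrow> Uo z"
      "\<And>y g. (y, g) \<in> S \<Longrightarrow> admissible y z (\<lambda>u. h (g u))" for z h
      by (rule a(3)) (use that in \<open>auto simp: H_def\<close>)
  qed
qed

lemma admissible_id: "x \<in> Ob X \<Longrightarrow> admissible x x (\<lambda>u. u)"
  using forgetful_functor Ide_hom[of x]
  by (auto simp: admissible_def is_functor_def Sets_def fun_of_def intro!: bexI[of _ "Ide X x"])


section \<open>Arrows between equilogical objects as functions\<close>

abbreviation E where "E \<equiv> Equ X Uo Ua"

abbreviation carrier :: "('o, 'u) equ_ob \<Rightarrow> 'u set" where "carrier S \<equiv> Uo (fst S)"

definition tracks :: "('o, 'u) equ_ob \<Rightarrow> ('o, 'u) equ_ob \<Rightarrow> ('u \<Rightarrow> 'u) \<Rightarrow> bool" where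
  "tracks S T f \<longleftrightarrow> admissible (fst S) (fst T) f \<and> (\<forall>(x, x') \<in> snd S. (f x, f x') \<in> snd T)"

text \<open>
  The whole equivalence class that a tracking function determines. It is described by \<open>f\<close> directly, so
  that it is defined without choosing an arrow of \<open>X\<close> over \<open>f\<close>.
\<close>

definition arrow :: "('o, 'u) equ_ob \<Rightarrow> ('u \<Rightarrow> 'u) \<Rightarrow> ('o, 'u) equ_ob \<Rightarrow> ('o, 'a, 'u) equ_ar" where
  "arrow S f T = (S, {\<phi> \<in> equivariant X Ua S T. \<forall>(x, x') \<in> snd S. (f x, fun_of (Ua \<phi>) x') \<in> snd T}, T)"

lemma Ob_Equ: "S \<in> Ob E \<longleftrightarrow> fst S \<in> Ob X \<and> equiv (carrier S) (snd S)"
  by (auto simp: Equ_def Let_def)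

lemma Dom_arrow [simp]: "Dom E (arrow S f T) = S" and Cod_arrow [simp]: "Cod E (arrow S f T) = T"
  by (simp_all add: Equ_def Let_def arrow_def)

lemma
  assumes "S \<in> Ob E"
  shows equ_refl: "x \<in> carrier S \<Longrightarrow> (x, x) \<in> snd S"
    and equ_sym: "(x, y) \<in> snd S \<Longrightarrow> (y, x) \<in> snd S"
    and equ_trans: "(x, y) \<in> snd S \<Longrightarrow> (y, z) \<in> snd S \<Longrightarrow> (x, z) \<in> snd S"
    and equ_carrier: "(x, y) \<in> snd S \<Longrightarrow> x \<in> carrier S \<and> y \<in> carrier S"
  using assms unfolding Ob_Equ equiv_def refl_on_def sym_def trans_def by blast+

lemma tracks_maps: "tracks S T f \<Longrightarrow> x \<in> carrier S \<Longrightarrow> f x \<in> carrier T"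
  using admissible_maps by (auto simp: tracks_def)

lemma tracks_related: "tracks S T f \<Longrightarrow> (x, y) \<in> snd S \<Longrightarrow> (f x, f y) \<in> snd T"
  by (auto simp: tracks_def)

lemma tracks_comp: "tracks S T f \<Longrightarrow> tracks T W g \<Longrightarrow> tracks S W (\<lambda>x. g (f x))"
  using admissible_comp by (fastforce simp: tracks_def)

lemma arrow_eq_class:
  assumes S: "S \<in> Ob E" and \<phi>: "\<phi> \<in> hom X (fst S) (fst T)"
    and eq: "\<And>x. x \<in> carrier S \<Longrightarrow> fun_of (Ua \<phi>) x = f x" and f: "tracks S T f"
  shows "\<phi> \<in> equivariant X Ua S T" "arrow S f T = (S, equ_rel X Ua S T `` {\<phi>}, T)"
proof -
  have *: "fun_of (Ua \<phi>) x = f x \<and> fun_of (Ua \<phi>) y = f y" if "(x, y) \<in> snd S" for x y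
    using equ_carrier[OF S that] eq by blast
  then show equivariant: "\<phi> \<in> equivariant X Ua S T"
    using \<phi> tracks_related[OF f] by (auto simp: equivariant_def)
  have "equ_rel X Ua S T `` {\<phi>} =
      {\<psi> \<in> equivariant X Ua S T. \<forall>(x, x') \<in> snd S. (f x, fun_of (Ua \<psi>) x') \<in> snd T}"
    using equivariant * by (auto simp: equ_rel_def)
  then show "arrow S f T = (S, equ_rel X Ua S T `` {\<phi>}, T)"
    by (simp add: arrow_def)
qed

lemma tracks_class:
  assumes "S \<in> Ob E" "tracks S T f"
  shows "\<exists>\<phi> \<in> equivariant X Ua S T. (\<forall>x \<in> carrier S. fun_of (Ua \<phi>) x = f x) \<and>
    arrow S f T = (S, equ_rel X Ua S T `` {\<phi>}, T)"
proof -
  obtain \<phi> where "\<phi> \<in> hom X (fst S) (fst T)" "\<forall>x \<in> carrier S. fun_of (Ua \<phi>) x = f x"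
    using assms(2) by (auto simp: tracks_def admissible_def)
  then show ?thesis using arrow_eq_class[OF assms(1) _ _ assms(2)] by blast
qed

lemma class_tracks:
  assumes S: "S \<in> Ob E" and \<phi>: "\<phi> \<in> equivariant X Ua S T"
  shows "tracks S T (fun_of (Ua \<phi>))"
    "arrow S (fun_of (Ua \<phi>)) T = (S, equ_rel X Ua S T `` {\<phi>}, T)"
proof -
  show t: "tracks S T (fun_of (Ua \<phi>))"
    using \<phi> by (auto simp: tracks_def equivariant_def admissible_def)
  show "arrow S (fun_of (Ua \<phi>)) T = (S, equ_rel X Ua S T `` {\<phi>}, T)"
    using arrow_eq_class(2)[OF S _ _ t] \<phi> by (simp add: equivariant_def)
qed

lemma hom_Equ:
  "k \<in> hom E S T \<longleftrightarrow> S \<in> Ob E \<and> T \<in> Ob E \<and> (\<exists>f. tracks S T f \<and> k = arrow S f T)"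
proof -
  have "k \<in> hom E S T \<longleftrightarrow> S \<in> Ob E \<and> T \<in> Ob E \<and>
      (\<exists>\<phi> \<in> equivariant X Ua S T. k = (S, equ_rel X Ua S T `` {\<phi>}, T))"
    by (auto simp: hom_def Equ_def Let_def quotient_def)
  moreover have "(\<exists>\<phi> \<in> equivariant X Ua S T. k = (S, equ_rel X Ua S T `` {\<phi>}, T)) \<longleftrightarrow>
      (\<exists>f. tracks S T f \<and> k = arrow S f T)" if S: "S \<in> Ob E"
  proof
    assume "\<exists>\<phi> \<in> equivariant X Ua S T. k = (S, equ_rel X Ua S T `` {\<phi>}, T)"
    then obtain \<phi> where \<phi>: "\<phi> \<in> equivariant X Ua S T" "k = (S, equ_rel X Ua S T `` {\<phi>}, T)"
      by (elim bexE)
    then show "\<exists>f. tracks S T f \<and> k = arrow S f T"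
      by (intro exI[of _ "fun_of (Ua \<phi>)"]) (simp add: class_tracks[OF S \<phi>(1)])
  next
    assume "\<exists>f. tracks S T f \<and> k = arrow S f T"
    then obtain f where f: "tracks S T f" "k = arrow S f T" by (elim exE conjE)
    then show "\<exists>\<phi> \<in> equivariant X Ua S T. k = (S, equ_rel X Ua S T `` {\<phi>}, T)"
      using tracks_class[OF S f(1)] by auto
  qed
  ultimately show ?thesis by blast
qed

lemma arrow_hom: "S \<in> Ob E \<Longrightarrow> T \<in> Ob E \<Longrightarrow> tracks S T f \<Longrightarrow> arrow S f T \<in> hom E S T"
  using hom_Equ by blast

lemma arrow_eq_iff:
  assumes S: "S \<in> Ob E" and T: "T \<in> Ob E" and f: "tracks S T f" and g: "tracks S T g"
  shows "arrow S f T = arrow S g T \<longleftrightarrow> (\<forall>x \<in> carrier S. (f x, g x) \<in> snd T)"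
proof -
  obtain \<phi> where \<phi>: "\<phi> \<in> equivariant X Ua S T" "\<And>x. x \<in> carrier S \<Longrightarrow> fun_of (Ua \<phi>) x = f x"
    "arrow S f T = (S, equ_rel X Ua S T `` {\<phi>}, T)"
    using tracks_class[OF S f] by blast
  obtain \<psi> where \<psi>: "\<psi> \<in> equivariant X Ua S T" "\<And>x. x \<in> carrier S \<Longrightarrow> fun_of (Ua \<psi>) x = g x"
    "arrow S g T = (S, equ_rel X Ua S T `` {\<psi>}, T)"
    using tracks_class[OF S g] by blast
  have "equiv (equivariant X Ua S T) (equ_rel X Ua S T)"
    using S T equiv_equ_rel Ob_Equ by blast
  then have "arrow S f T = arrow S g T \<longleftrightarrow> (\<phi>, \<psi>) \<in> equ_rel X Ua S T"
    using \<phi> \<psi> by (simp add: eq_equiv_class_iff)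
  also have "\<dots> \<longleftrightarrow> (\<forall>(x, y) \<in> snd S. (fun_of (Ua \<phi>) x, fun_of (Ua \<psi>) y) \<in> snd T)"
    using \<phi>(1) \<psi>(1) by (auto simp: equ_rel_def)
  also have "\<dots> \<longleftrightarrow> (\<forall>x \<in> carrier S. (f x, g x) \<in> snd T)" (is "?L \<longleftrightarrow> ?R")
  proof
    assume L: ?L
    show ?R
    proof
      fix x assume x: "x \<in> carrier S"
      then have "(fun_of (Ua \<phi>) x, fun_of (Ua \<psi>) x) \<in> snd T" using L equ_refl[OF S x] by blast
      then show "(f x, g x) \<in> snd T" using \<phi>(2)[OF x] \<psi>(2)[OF x] by simp
    qed
  next
    assume R: ?R
    have "(fun_of (Ua \<phi>) x, fun_of (Ua \<psi>) y) \<in> snd T" if xy: "(x, y) \<in> snd S" for x y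
    proof -
      have x: "x \<in> carrier S" and y: "y \<in> carrier S" using equ_carrier[OF S xy] by blast+
      have "(f x, g y) \<in> snd T"
        using R x tracks_related[OF g xy] equ_trans[OF T] by blast
      then show ?thesis using \<phi>(2)[OF x] \<psi>(2)[OF y] by simp
    qed
    then show ?L by blast
  qed
  finally show ?thesis .
qed

lemma Comp_arrow:
  assumes S: "S \<in> Ob E" and T: "T \<in> Ob E" and W: "W \<in> Ob E"
    and f: "tracks S T f" and g: "tracks T W g"
  shows "Comp E (arrow T g W) (arrow S f T) = arrow S (\<lambda>x. g (f x)) W"
proof -
  obtain \<phi> where \<phi>: "\<phi> \<in> equivariant X Ua S T" "\<And>x. x \<in> carrier S \<Longrightarrow> fun_of (Ua \<phi>) x = f x"
    "arrow S f T = (S, equ_rel X Ua S T `` {\<phi>}, T)"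
    using tracks_class[OF S f] by blast
  obtain \<psi> where \<psi>: "\<psi> \<in> equivariant X Ua T W" "\<And>x. x \<in> carrier T \<Longrightarrow> fun_of (Ua \<psi>) x = g x"
    "arrow T g W = (T, equ_rel X Ua T W `` {\<psi>}, W)"
    using tracks_class[OF T g] by blast
  have h: "\<phi> \<in> hom X (fst S) (fst T)" "\<psi> \<in> hom X (fst T) (fst W)"
    using \<phi>(1) \<psi>(1) by (simp_all add: equivariant_def)
  have "fun_of (Ua (Comp X \<psi> \<phi>)) x = g (f x)" if "x \<in> carrier S" for x
    using fun_of_Comp[OF category_axioms forgetful_functor h that] \<phi>(2)[OF that] \<psi>(2)
      tracks_maps[OF f that] by simp
  then have "arrow S (\<lambda>x. g (f x)) W = (S, equ_rel X Ua S W `` {Comp X \<psi> \<phi>}, W)"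
    using arrow_eq_class(2)[OF S Comp_hom[OF h] _ tracks_comp[OF f g]] by blast
  then show ?thesis
    using equ_comp_class[OF category_axioms forgetful_functor _ _ _ \<phi>(1) \<psi>(1)] S T W \<phi>(3) \<psi>(3)
    by (simp add: Ob_Equ)
qed

lemma category_E: "category E"
  using category_Equ[OF category_axioms forgetful_functor] .

lemma equiv_pullback:
  assumes S: "S \<in> Ob E" and h: "\<And>v. v \<in> A \<Longrightarrow> h v \<in> carrier S"
  shows "equiv A {(v, w) \<in> A \<times> A. (h v, h w) \<in> snd S}"
proof (rule equivI)
  show "refl_on A {(v, w) \<in> A \<times> A. (h v, h w) \<in> snd S}"
    using equ_refl[OF S h] by (auto simp: refl_on_def)
  show "sym {(v, w) \<in> A \<times> A. (h v, h w) \<in> snd S}"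
    using equ_sym[OF S] by (auto simp: sym_def)
  show "trans {(v, w) \<in> A \<times> A. (h v, h w) \<in> snd S}"
    unfolding trans_def using equ_trans[OF S] by blast
qed auto


section \<open>Limits\<close>

text \<open>
  Only the arrows of a diagram are represented, one by one. The chosen functions compose as the
  diagram does merely up to equivalence, which is all that cones and cocones can detect.
\<close>

lemma diagram_representatives:
  assumes D: "small_diagram J E Do Da"
  obtains d where "\<And>k. k \<in> Ar J \<Longrightarrow> tracks (Do (Dom J k)) (Do (Cod J k)) (d k)"
    "\<And>k. k \<in> Ar J \<Longrightarrow> Da k = arrow (Do (Dom J k)) (d k) (Do (Cod J k))"
    "\<And>j. j \<in> Ob J \<Longrightarrow> Do j \<in> Ob E"
    "\<And>k. k \<in> Ar J \<Longrightarrow> Dom J k \<in> Ob J \<and> Cod J k \<in> Ob J"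
proof -
  have J: "category J" and F: "is_functor J E Do Da" using D by (simp_all add: small_diagram_def)
  have ob: "Dom J k \<in> Ob J \<and> Cod J k \<in> Ob J" if "k \<in> Ar J" for k
    using category.Dom_Ob[OF J that] category.Cod_Ob[OF J that] by blast
  have "\<exists>f. tracks (Do (Dom J k)) (Do (Cod J k)) f \<and> Da k = arrow (Do (Dom J k)) f (Do (Cod J k))"
    if "k \<in> Ar J" for k
  proof -
    have "k \<in> hom J (Dom J k) (Cod J k)" using that by (simp add: hom_def)
    then have "Da k \<in> hom E (Do (Dom J k)) (Do (Cod J k))"
      using F ob[OF that] unfolding is_functor_def by blast
    then show ?thesis unfolding hom_Equ by blast
  qed
  then obtain d where "\<forall>k\<in>Ar J. tracks (Do (Dom J k)) (Do (Cod J k)) (d k) \<and>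
      Da k = arrow (Do (Dom J k)) (d k) (Do (Cod J k))"
    by metis
  moreover have "Do j \<in> Ob E" if "j \<in> Ob J" for j
    using F that by (simp add: is_functor_def)
  ultimately show thesis using that ob by blast
qed

context
  fixes J :: "('u, 'u) cat" and Do Da d
  assumes Do: "\<And>j. j \<in> Ob J \<Longrightarrow> Do j \<in> Ob E"
    and J: "\<And>k. k \<in> Ar J \<Longrightarrow> Dom J k \<in> Ob J \<and> Cod J k \<in> Ob J"
    and d: "\<And>k. k \<in> Ar J \<Longrightarrow> tracks (Do (Dom J k)) (Do (Cod J k)) (d k)"
    and Da: "\<And>k. k \<in> Ar J \<Longrightarrow> Da k = arrow (Do (Dom J k)) (d k) (Do (Cod J k))"
begin

text \<open>
  A cone at the level of functions: the triangles commute up to equivalence in the diagram.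
\<close>

definition tracks_cone :: "('o, 'u) equ_ob \<Rightarrow> ('u \<Rightarrow> 'u \<Rightarrow> 'u) \<Rightarrow> bool" where
  "tracks_cone m f \<longleftrightarrow> m \<in> Ob E \<and> (\<forall>j\<in>Ob J. tracks m (Do j) (f j)) \<and>
    (\<forall>k\<in>Ar J. \<forall>u\<in>carrier m. (d k (f (Dom J k) u), f (Cod J k) u) \<in> snd (Do (Cod J k)))"

lemma is_cone_Equ:
  assumes f: "\<And>j. j \<in> Ob J \<Longrightarrow> tracks m (Do j) (f j)"
    and \<mu>: "\<And>j. j \<in> Ob J \<Longrightarrow> \<mu> j = arrow m (f j) (Do j)"
  shows "is_cone J E Do Da m \<mu> \<longleftrightarrow> tracks_cone m f"
proof (cases "m \<in> Ob E")
  case m: True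
  have "Comp E (Da k) (\<mu> (Dom J k)) = \<mu> (Cod J k) \<longleftrightarrow>
      (\<forall>u\<in>carrier m. (d k (f (Dom J k) u), f (Cod J k) u) \<in> snd (Do (Cod J k)))"
    if k: "k \<in> Ar J" for k
  proof -
    have dom: "Dom J k \<in> Ob J" and cod: "Cod J k \<in> Ob J" using J[OF k] by blast+
    have "Comp E (Da k) (\<mu> (Dom J k)) = arrow m (\<lambda>u. d k (f (Dom J k) u)) (Do (Cod J k))"
      unfolding Da[OF k] \<mu>[OF dom] by (rule Comp_arrow[OF m Do[OF dom] Do[OF cod] f[OF dom] d[OF k]])
    then show ?thesis
      using arrow_eq_iff[OF m Do[OF cod] tracks_comp[OF f[OF dom] d[OF k]] f[OF cod]] \<mu>[OF cod]
      by simp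
  qed
  moreover have "\<mu> j \<in> hom E m (Do j)" if "j \<in> Ob J" for j
    unfolding \<mu>[OF that] by (rule arrow_hom[OF m Do[OF that] f[OF that]])
  ultimately show ?thesis unfolding is_cone_def tracks_cone_def using m f by blast
qed (simp add: is_cone_def tracks_cone_def)

lemma cone_representatives:
  assumes "is_cone J E Do Da m \<mu>"
  shows "\<exists>f. tracks_cone m f \<and> (\<forall>j\<in>Ob J. \<mu> j = arrow m (f j) (Do j))"
proof -
  have "\<forall>j\<in>Ob J. \<exists>f. tracks m (Do j) f \<and> \<mu> j = arrow m f (Do j)"
    using assms unfolding is_cone_def hom_Equ by blast
  then obtain f where f: "\<And>j. j \<in> Ob J \<Longrightarrow> tracks m (Do j) (f j)"
    "\<And>j. j \<in> Ob J \<Longrightarrow> \<mu> j = arrow m (f j) (Do j)"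
    using bchoice[of "Ob J" "\<lambda>j f. tracks m (Do j) f \<and> \<mu> j = arrow m f (Do j)"] by blast
  then show ?thesis using is_cone_Equ[of m f \<mu>] assms by blast
qed

text \<open>
  The two conditions on a cone of functions are existence and uniqueness of the mediating arrow: maps
  into \<open>l\<close> are equal as soon as they have equivalent projections, because the relation of \<open>l\<close> is
  determined by the projections.
\<close>

lemma is_limit_Equ:
  assumes p: "tracks_cone l p"
    and factor: "\<And>m f. tracks_cone m f \<Longrightarrow>
      \<exists>h. tracks m l h \<and> (\<forall>j\<in>Ob J. \<forall>u\<in>carrier m. (p j (h u), f j u) \<in> snd (Do j))"
    and joint: "\<And>u v. u \<in> carrier l \<Longrightarrow> v \<in> carrier l \<Longrightarrow>
      (\<And>j. j \<in> Ob J \<Longrightarrow> (p j u, p j v) \<in> snd (Do j)) \<Longrightarrow> (u, v) \<in> snd l"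
  shows "is_limit J E Do Da l (\<lambda>j. arrow l (p j) (Do j))"
  unfolding is_limit_def
proof (intro conjI allI impI)
  have l: "l \<in> Ob E" and pj: "\<And>j. j \<in> Ob J \<Longrightarrow> tracks l (Do j) (p j)"
    using p by (auto simp: tracks_cone_def)
  show "is_cone J E Do Da l (\<lambda>j. arrow l (p j) (Do j))"
    by (rule iffD2[OF is_cone_Equ[OF pj refl] p])
  fix m \<mu> assume "is_cone J E Do Da m \<mu>"
  then obtain f where f: "tracks_cone m f" and \<mu>: "\<And>j. j \<in> Ob J \<Longrightarrow> \<mu> j = arrow m (f j) (Do j)"
    using cone_representatives by blast
  then have m: "m \<in> Ob E" and fj: "\<And>j. j \<in> Ob J \<Longrightarrow> tracks m (Do j) (f j)"
    by (auto simp: tracks_cone_def)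
  have Comp_iff: "Comp E (arrow l (p j) (Do j)) (arrow m g l) = \<mu> j \<longleftrightarrow>
      (\<forall>u\<in>carrier m. (p j (g u), f j u) \<in> snd (Do j))" if "j \<in> Ob J" "tracks m l g" for j g
    unfolding \<mu>[OF that(1)] Comp_arrow[OF m l Do[OF that(1)] that(2) pj[OF that(1)]]
    by (rule arrow_eq_iff[OF m Do[OF that(1)] tracks_comp[OF that(2) pj[OF that(1)]] fj[OF that(1)]])
  obtain h where h: "tracks m l h" "\<And>j u. j \<in> Ob J \<Longrightarrow> u \<in> carrier m \<Longrightarrow> (p j (h u), f j u) \<in> snd (Do j)"
    using factor[OF f] by blast
  show "\<exists>!h. h \<in> hom E m l \<and> (\<forall>j\<in>Ob J. Comp E (arrow l (p j) (Do j)) h = \<mu> j)"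
  proof (rule ex1I[of _ "arrow m h l"])
    show "arrow m h l \<in> hom E m l \<and> (\<forall>j\<in>Ob J. Comp E (arrow l (p j) (Do j)) (arrow m h l) = \<mu> j)"
      using arrow_hom[OF m l h(1)] Comp_iff[OF _ h(1)] h(2) by blast
    fix k assume k: "k \<in> hom E m l \<and> (\<forall>j\<in>Ob J. Comp E (arrow l (p j) (Do j)) k = \<mu> j)"
    then obtain g where g: "tracks m l g" "k = arrow m g l" unfolding hom_Equ by blast
    have "(g u, h u) \<in> snd l" if u: "u \<in> carrier m" for u
    proof (rule joint)
      show "g u \<in> carrier l" "h u \<in> carrier l" using tracks_maps u g(1) h(1) by blast+
      fix j assume j: "j \<in> Ob J"
      then have "(p j (g u), f j u) \<in> snd (Do j)" using k g Comp_iff[OF j g(1)] u by blast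
      then show "(p j (g u), p j (h u)) \<in> snd (Do j)"
        using h(2)[OF j u] equ_sym[OF Do[OF j]] equ_trans[OF Do[OF j]] by blast
    qed
    then show "k = arrow m h l" using arrow_eq_iff[OF m l g(1) h(1)] g(2) by blast
  qed
qed

text \<open>
  The tuples that are compatible up to equivalence, coded by elements of \<open>'u\<close> through \<open>e\<close>; \<open>p j\<close>
  decodes a tuple and projects it to \<open>j\<close>. Given a cone of functions \<open>f\<close>, the mediating function \<open>h\<close>
  collects their values; these form a compatible tuple because the triangles of the cone commute in
  exactly the sense in which tuples are compatible.
\<close>

lemma limit_exists:
  assumes u: "universe TYPE('u)" and small_J: "small TYPE('u) (Ob J)"
  shows "\<exists>l \<pi>. is_limit J E Do Da l \<pi>"
proof -
  define L where "L = {x \<in> PiE (Ob J) (\<lambda>j. carrier (Do j)).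
    \<forall>k\<in>Ar J. (d k (x (Dom J k)), x (Cod J k)) \<in> snd (Do (Cod J k))}"
  have "small TYPE('u) (PiE (Ob J) (\<lambda>j. carrier (Do j)))"
  proof (rule small_PiE[OF u small_J])
    show "small TYPE('u) (carrier (Do j))" if "j \<in> Ob J" for j
      using small_Uo Do[OF that] by (simp add: Ob_Equ)
  qed
  then have small_L: "small TYPE('u) L" by (rule small_subset) (auto simp: L_def)
  then obtain e :: "('u \<Rightarrow> 'u) \<Rightarrow> 'u" where e: "inj_on e L" by (rule small_embeds)
  define A where "A = e ` L"
  define p where "p j v = inv_into L e v j" for j v
  have decode: "inv_into L e v \<in> L" if "v \<in> A" for v
    using that unfolding A_def by (rule inv_into_into)
  have p_e: "p j (e x) = x j" if "x \<in> L" for j x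
    using that e by (simp add: p_def)
  have "small TYPE('u) A" using small_L small_image unfolding A_def by blast
  moreover have p_maps: "p j v \<in> carrier (Do j)" if "j \<in> Ob J" "v \<in> A" for j v
    using decode[OF that(2)] that(1) by (auto simp: p_def L_def)
  then have "y \<in> Ob X \<and> g \<in> A \<rightarrow> Uo y" if "(y, g) \<in> (\<lambda>j. (fst (Do j), p j)) ` Ob J" for y g
    using that Do Ob_Equ by auto
  ultimately obtain a where a: "a \<in> Ob X" "Uo a = A"
    "\<And>y g. (y, g) \<in> (\<lambda>j. (fst (Do j), p j)) ` Ob J \<Longrightarrow> admissible a y g"
    "\<And>z h. z \<in> Ob X \<Longrightarrow> h \<in> Uo z \<rightarrow> A \<Longrightarrow>
      (\<And>y g. (y, g) \<in> (\<lambda>j. (fst (Do j), p j)) ` Ob J \<Longrightarrow> admissible z y (\<lambda>u. g (h u))) \<Longrightarrow>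
      admissible z a h"
    by (rule initial_lift[where S = "(\<lambda>j. (fst (Do j), p j)) ` Ob J"]) blast+
  define R where "R = {(v, w) \<in> A \<times> A. \<forall>j\<in>Ob J. (p j v, p j w) \<in> snd (Do j)}"
  let ?l = "(a, R)"
  have "equiv A R"
  proof (rule equivI)
    show "R \<subseteq> A \<times> A" by (auto simp: R_def)
    show "refl_on A R" using p_maps equ_refl[OF Do] by (auto simp: R_def refl_on_def)
    show "sym R" using equ_sym[OF Do] by (auto simp: R_def sym_def)
    show "trans R" unfolding R_def trans_def using equ_trans[OF Do] by blast
  qed
  then have l: "?l \<in> Ob E" using a by (simp add: Ob_Equ)
  have "is_limit J E Do Da ?l (\<lambda>j. arrow ?l (p j) (Do j))"
  proof (rule is_limit_Equ)
    have "tracks ?l (Do j) (p j)" if "j \<in> Ob J" for j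
      using that a(3) by (auto simp: tracks_def R_def)
    moreover have "(d k (p (Dom J k) v), p (Cod J k) v) \<in> snd (Do (Cod J k))"
      if "k \<in> Ar J" "v \<in> A" for k v
      using decode[OF that(2)] that(1) by (auto simp: p_def L_def)
    ultimately show "tracks_cone ?l p" using l a(2) by (simp add: tracks_cone_def)
    show "(v, w) \<in> snd ?l" if "v \<in> carrier ?l" "w \<in> carrier ?l"
      "\<And>j. j \<in> Ob J \<Longrightarrow> (p j v, p j w) \<in> snd (Do j)" for v w
      using that a(2) by (simp add: R_def)
  next
    fix m f assume f: "tracks_cone m f"
    then have m: "m \<in> Ob E" and fj: "\<And>j. j \<in> Ob J \<Longrightarrow> tracks m (Do j) (f j)"
      and compat: "\<And>k u. k \<in> Ar J \<Longrightarrow> u \<in> carrier m \<Longrightarrow>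
        (d k (f (Dom J k) u), f (Cod J k) u) \<in> snd (Do (Cod J k))"
      by (auto simp: tracks_cone_def)
    define h where "h u = e (\<lambda>j\<in>Ob J. f j u)" for u
    have in_L: "(\<lambda>j\<in>Ob J. f j u) \<in> L" if "u \<in> carrier m" for u
      using compat[OF _ that] tracks_maps[OF fj that] J by (auto simp: L_def)
    have p_h: "p j (h u) = f j u" if "j \<in> Ob J" "u \<in> carrier m" for j u
      using p_e[OF in_L[OF that(2)]] that(1) by (simp add: h_def)
    have h_maps: "h u \<in> A" if "u \<in> carrier m" for u
      using in_L[OF that] by (simp add: h_def A_def)
    have "admissible (fst m) y (\<lambda>u. g (h u))" if yg: "(y, g) \<in> (\<lambda>j. (fst (Do j), p j)) ` Ob J" for y g
    proof -
      obtain j where j: "j \<in> Ob J" "y = fst (Do j)" "g = p j" using yg by auto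
      show ?thesis using fj[OF j(1)] admissible_cong[of "fst m" "\<lambda>u. p j (h u)" "f j"] p_h[OF j(1)]
        by (simp add: j(2,3) tracks_def)
    qed
    then have "admissible (fst m) a h"
      using a(4)[of "fst m" h] m h_maps Ob_Equ by blast
    moreover have "(h u, h v) \<in> R" if uv: "(u, v) \<in> snd m" for u v
    proof -
      have "u \<in> carrier m" "v \<in> carrier m" using equ_carrier[OF m uv] by auto
      then show ?thesis using h_maps p_h tracks_related[OF fj uv] by (simp add: R_def)
    qed
    ultimately have "tracks m ?l h" by (auto simp: tracks_def)
    moreover have "(p j (h u), f j u) \<in> snd (Do j)" if "j \<in> Ob J" "u \<in> carrier m" for j u
      using p_h[OF that] equ_refl[OF Do[OF that(1)] tracks_maps[OF fj[OF that(1)] that(2)]] by simp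
    ultimately show "\<exists>h. tracks m ?l h \<and> (\<forall>j\<in>Ob J. \<forall>u\<in>carrier m. (p j (h u), f j u) \<in> snd (Do j))"
      by blast
  qed
  then show ?thesis by blast
qed

section \<open>Colimits\<close>

definition tracks_cocone :: "('o, 'u) equ_ob \<Rightarrow> ('u \<Rightarrow> 'u \<Rightarrow> 'u) \<Rightarrow> bool" where
  "tracks_cocone m f \<longleftrightarrow> m \<in> Ob E \<and> (\<forall>j\<in>Ob J. tracks (Do j) m (f j)) \<and>
    (\<forall>k\<in>Ar J. \<forall>u\<in>carrier (Do (Dom J k)). (f (Cod J k) (d k u), f (Dom J k) u) \<in> snd m)"

lemma is_cocone_Equ:
  assumes f: "\<And>j. j \<in> Ob J \<Longrightarrow> tracks (Do j) m (f j)"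
    and \<mu>: "\<And>j. j \<in> Ob J \<Longrightarrow> \<mu> j = arrow (Do j) (f j) m"
  shows "is_cocone J E Do Da m \<mu> \<longleftrightarrow> tracks_cocone m f"
proof (cases "m \<in> Ob E")
  case m: True
  have "Comp E (\<mu> (Cod J k)) (Da k) = \<mu> (Dom J k) \<longleftrightarrow>
      (\<forall>u\<in>carrier (Do (Dom J k)). (f (Cod J k) (d k u), f (Dom J k) u) \<in> snd m)"
    if k: "k \<in> Ar J" for k
  proof -
    have dom: "Dom J k \<in> Ob J" and cod: "Cod J k \<in> Ob J" using J[OF k] by blast+
    have "Comp E (\<mu> (Cod J k)) (Da k) = arrow (Do (Dom J k)) (\<lambda>u. f (Cod J k) (d k u)) m"
      unfolding Da[OF k] \<mu>[OF cod] by (rule Comp_arrow[OF Do[OF dom] Do[OF cod] m d[OF k] f[OF cod]])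
    then show ?thesis
      using arrow_eq_iff[OF Do[OF dom] m tracks_comp[OF d[OF k] f[OF cod]] f[OF dom]] \<mu>[OF dom]
      by simp
  qed
  moreover have "\<mu> j \<in> hom E (Do j) m" if "j \<in> Ob J" for j
    unfolding \<mu>[OF that] by (rule arrow_hom[OF Do[OF that] m f[OF that]])
  ultimately show ?thesis unfolding is_cocone_def tracks_cocone_def using m f by blast
qed (simp add: is_cocone_def tracks_cocone_def)

lemma cocone_representatives:
  assumes "is_cocone J E Do Da m \<mu>"
  shows "\<exists>f. tracks_cocone m f \<and> (\<forall>j\<in>Ob J. \<mu> j = arrow (Do j) (f j) m)"
proof -
  have "\<forall>j\<in>Ob J. \<exists>f. tracks (Do j) m f \<and> \<mu> j = arrow (Do j) f m"
    using assms unfolding is_cocone_def hom_Equ by blast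
  then obtain f where f: "\<And>j. j \<in> Ob J \<Longrightarrow> tracks (Do j) m (f j)"
    "\<And>j. j \<in> Ob J \<Longrightarrow> \<mu> j = arrow (Do j) (f j) m"
    using bchoice[of "Ob J" "\<lambda>j f. tracks (Do j) m f \<and> \<mu> j = arrow (Do j) f m"] by blast
  then show ?thesis using is_cocone_Equ[of m f \<mu>] assms by blast
qed

text \<open>
  Uniqueness of the mediating arrow comes from joint surjectivity of the injections on underlying sets;
  equivalence in the target is tested pointwise.
\<close>

lemma is_colimit_Equ:
  assumes i: "tracks_cocone l i"
    and factor: "\<And>m f. tracks_cocone m f \<Longrightarrow>
      \<exists>h. tracks l m h \<and> (\<forall>j\<in>Ob J. \<forall>u\<in>carrier (Do j). (h (i j u), f j u) \<in> snd m)"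
    and joint: "\<And>v. v \<in> carrier l \<Longrightarrow> \<exists>j\<in>Ob J. \<exists>u\<in>carrier (Do j). v = i j u"
  shows "is_colimit J E Do Da l (\<lambda>j. arrow (Do j) (i j) l)"
  unfolding is_colimit_def
proof (intro conjI allI impI)
  have l: "l \<in> Ob E" and ij: "\<And>j. j \<in> Ob J \<Longrightarrow> tracks (Do j) l (i j)"
    using i by (auto simp: tracks_cocone_def)
  show "is_cocone J E Do Da l (\<lambda>j. arrow (Do j) (i j) l)"
    by (rule iffD2[OF is_cocone_Equ[OF ij refl] i])
  fix m \<mu> assume "is_cocone J E Do Da m \<mu>"
  then obtain f where f: "tracks_cocone m f" and \<mu>: "\<And>j. j \<in> Ob J \<Longrightarrow> \<mu> j = arrow (Do j) (f j) m"
    using cocone_representatives by blast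
  then have m: "m \<in> Ob E" and fj: "\<And>j. j \<in> Ob J \<Longrightarrow> tracks (Do j) m (f j)"
    by (auto simp: tracks_cocone_def)
  have Comp_iff: "Comp E (arrow l g m) (arrow (Do j) (i j) l) = \<mu> j \<longleftrightarrow>
      (\<forall>u\<in>carrier (Do j). (g (i j u), f j u) \<in> snd m)" if "j \<in> Ob J" "tracks l m g" for j g
    unfolding \<mu>[OF that(1)] Comp_arrow[OF Do[OF that(1)] l m ij[OF that(1)] that(2)]
    by (rule arrow_eq_iff[OF Do[OF that(1)] m tracks_comp[OF ij[OF that(1)] that(2)] fj[OF that(1)]])
  obtain h where h: "tracks l m h" "\<And>j u. j \<in> Ob J \<Longrightarrow> u \<in> carrier (Do j) \<Longrightarrow> (h (i j u), f j u) \<in> snd m"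
    using factor[OF f] by blast
  show "\<exists>!h. h \<in> hom E l m \<and> (\<forall>j\<in>Ob J. Comp E h (arrow (Do j) (i j) l) = \<mu> j)"
  proof (rule ex1I[of _ "arrow l h m"])
    show "arrow l h m \<in> hom E l m \<and> (\<forall>j\<in>Ob J. Comp E (arrow l h m) (arrow (Do j) (i j) l) = \<mu> j)"
      using arrow_hom[OF l m h(1)] Comp_iff[OF _ h(1)] h(2) by blast
    fix k assume k: "k \<in> hom E l m \<and> (\<forall>j\<in>Ob J. Comp E k (arrow (Do j) (i j) l) = \<mu> j)"
    then obtain g where g: "tracks l m g" "k = arrow l g m" unfolding hom_Equ by blast
    have "(g v, h v) \<in> snd m" if v: "v \<in> carrier l" for v
    proof -
      obtain j u where j: "j \<in> Ob J" and u: "u \<in> carrier (Do j)" "v = i j u" using joint[OF v] by (elim bexE)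
      have "\<forall>u\<in>carrier (Do j). (g (i j u), f j u) \<in> snd m"
        using k[THEN conjunct2, THEN bspec, OF j] unfolding g(2) Comp_iff[OF j g(1)] .
      then have "(g (i j u), f j u) \<in> snd m" using u(1) by blast
      then show ?thesis
        unfolding u(2) by (rule equ_trans[OF m _ equ_sym[OF m h(2)[OF j u(1)]]])
    qed
    then show "k = arrow l h m" using arrow_eq_iff[OF l m g(1) h(1)] g(2) by blast
  qed
qed

text \<open>
  The disjoint union, coded by elements of \<open>'u\<close> through \<open>e\<close>, with final structure for the injections
  \<open>i j\<close>. The relation identifies what each component identifies, and each element with its images
  under the arrows of the diagram. A cocone of functions defines a function \<open>h\<close> on the union by cases;
  that \<open>h\<close> respects the generated relation holds because the pairs with equivalent values under \<open>h\<close>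
  form an equivalence relation containing the generators.
\<close>

lemma colimit_exists:
  assumes u: "universe TYPE('u)" and small_J: "small TYPE('u) (Ob J)"
  shows "\<exists>l \<iota>. is_colimit J E Do Da l \<iota>"
proof -
  let ?D = "SIGMA j:Ob J. carrier (Do j)"
  have "small TYPE('u) ?D"
  proof (rule small_Sigma[OF u small_J])
    show "small TYPE('u) (carrier (Do j))" if "j \<in> Ob J" for j
      using small_Uo Do[OF that] by (simp add: Ob_Equ)
  qed
  then obtain e :: "'u \<times> 'u \<Rightarrow> 'u" where e: "inj_on e ?D" by (rule small_embeds)
  define A where "A = e ` ?D"
  define i where "i j x = e (j, x)" for j x
  have i_maps: "i j x \<in> A" if "j \<in> Ob J" "x \<in> carrier (Do j)" for j x
    using that by (auto simp: A_def i_def)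
  have i_cases: "\<exists>j\<in>Ob J. \<exists>x\<in>carrier (Do j). v = i j x" if "v \<in> A" for v
    using that by (auto simp: A_def i_def)
  have "small TYPE('u) A" unfolding A_def by (rule small_image) fact
  moreover have "y \<in> Ob X \<and> g \<in> Uo y \<rightarrow> A" if "(y, g) \<in> (\<lambda>j. (fst (Do j), i j)) ` Ob J" for y g
    using that Do i_maps by (auto simp: Ob_Equ)
  ultimately obtain a where a: "a \<in> Ob X" "Uo a = A"
    "\<And>y g. (y, g) \<in> (\<lambda>j. (fst (Do j), i j)) ` Ob J \<Longrightarrow> admissible y a g"
    "\<And>z h. z \<in> Ob X \<Longrightarrow> h \<in> A \<rightarrow> Uo z \<Longrightarrow>
      (\<And>y g. (y, g) \<in> (\<lambda>j. (fst (Do j), i j)) ` Ob J \<Longrightarrow> admissible y z (\<lambda>u. h (g u))) \<Longrightarrow>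
      admissible a z h"
    by (rule final_lift[where S = "(\<lambda>j. (fst (Do j), i j)) ` Ob J"]) blast+
  define G where "G = {(i j x, i j y) | j x y. j \<in> Ob J \<and> (x, y) \<in> snd (Do j)} \<union>
    {(i (Cod J k) (d k x), i (Dom J k) x) | k x. k \<in> Ar J \<and> x \<in> carrier (Do (Dom J k))}"
  have "G \<subseteq> A \<times> A"
  proof -
    have "i j x \<in> A \<and> i j y \<in> A" if "j \<in> Ob J" "(x, y) \<in> snd (Do j)" for j x y
      using equ_carrier[OF Do[OF that(1)] that(2)] i_maps[OF that(1)] by blast
    moreover have "i (Cod J k) (d k x) \<in> A \<and> i (Dom J k) x \<in> A"
      if "k \<in> Ar J" "x \<in> carrier (Do (Dom J k))" for k x
      using J[OF that(1)] tracks_maps[OF d[OF that(1)] that(2)] i_maps that(2) by blast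
    ultimately show ?thesis unfolding G_def by blast
  qed
  define R where "R = generated_equiv A G"
  have G_R: "G \<subseteq> R" unfolding R_def by (rule generated_equiv_contains) fact
  have R_fibre: "(i j x, i j y) \<in> R" if "j \<in> Ob J" "(x, y) \<in> snd (Do j)" for j x y
    using that by (intro subsetD[OF G_R]) (unfold G_def, blast)
  have R_glue: "(i (Cod J k) (d k x), i (Dom J k) x) \<in> R"
    if "k \<in> Ar J" "x \<in> carrier (Do (Dom J k))" for k x
    using that by (intro subsetD[OF G_R]) (unfold G_def, blast)
  let ?l = "(a, R)"
  have l: "?l \<in> Ob E" using a(1,2) equiv_generated_equiv by (simp add: Ob_Equ R_def)
  have "is_colimit J E Do Da ?l (\<lambda>j. arrow (Do j) (i j) ?l)"
  proof (rule is_colimit_Equ)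
    have "tracks (Do j) ?l (i j)" if "j \<in> Ob J" for j
      using that a(3) R_fibre by (auto simp: tracks_def)
    then show "tracks_cocone ?l i" using l R_glue by (simp add: tracks_cocone_def)
    show "\<exists>j\<in>Ob J. \<exists>x\<in>carrier (Do j). v = i j x" if "v \<in> carrier ?l" for v
      using i_cases that a(2) by simp
  next
    fix m f assume f: "tracks_cocone m f"
    then have m: "m \<in> Ob E" and fj: "\<And>j. j \<in> Ob J \<Longrightarrow> tracks (Do j) m (f j)"
      and compat: "\<And>k u. k \<in> Ar J \<Longrightarrow> u \<in> carrier (Do (Dom J k)) \<Longrightarrow>
        (f (Cod J k) (d k u), f (Dom J k) u) \<in> snd m"
      by (auto simp: tracks_cocone_def)
    define h where "h v = (case inv_into ?D e v of (j, x) \<Rightarrow> f j x)" for v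
    have h_i: "h (i j x) = f j x" if "j \<in> Ob J" "x \<in> carrier (Do j)" for j x
      using inv_into_f_f[OF e, of "(j, x)"] that by (simp add: h_def i_def)
    have h_maps: "h v \<in> carrier m" if "v \<in> A" for v
      using i_cases[OF that] h_i tracks_maps[OF fj] by auto
    have "admissible y (fst m) (\<lambda>u. h (g u))" if yg: "(y, g) \<in> (\<lambda>j. (fst (Do j), i j)) ` Ob J" for y g
    proof -
      obtain j where j: "j \<in> Ob J" "y = fst (Do j)" "g = i j" using yg by auto
      show ?thesis using fj[OF j(1)] admissible_cong[of "fst (Do j)" "\<lambda>u. h (i j u)" "f j"] h_i[OF j(1)]
        by (simp add: j(2,3) tracks_def)
    qed
    then have "admissible a (fst m) h"
      using a(4)[of "fst m" h] m h_maps Ob_Equ by blast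
    moreover have "R \<subseteq> {(v, w) \<in> A \<times> A. (h v, h w) \<in> snd m}"
      unfolding R_def
    proof (rule generated_equiv_least)
      show "equiv A {(v, w) \<in> A \<times> A. (h v, h w) \<in> snd m}"
        by (rule equiv_pullback[OF m h_maps])
      have "(h (i j x), h (i j y)) \<in> snd m" if "j \<in> Ob J" "(x, y) \<in> snd (Do j)" for j x y
        using equ_carrier[OF Do[OF that(1)] that(2)] h_i[OF that(1)] tracks_related[OF fj[OF that(1)] that(2)]
        by simp
      moreover have "(h (i (Cod J k) (d k x)), h (i (Dom J k) x)) \<in> snd m"
        if "k \<in> Ar J" "x \<in> carrier (Do (Dom J k))" for k x
      proof -
        have "Dom J k \<in> Ob J" "Cod J k \<in> Ob J" using J[OF that(1)] by blast+
        then show ?thesis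
          using h_i tracks_maps[OF d[OF that(1)] that(2)] compat[OF that] that(2) by simp
      qed
      ultimately show "G \<subseteq> {(v, w) \<in> A \<times> A. (h v, h w) \<in> snd m}"
        using \<open>G \<subseteq> A \<times> A\<close> unfolding G_def by blast
    qed
    ultimately have "tracks ?l m h" by (auto simp: tracks_def)
    moreover have "(h (i j x), f j x) \<in> snd m" if "j \<in> Ob J" "x \<in> carrier (Do j)" for j x
      using h_i[OF that] equ_refl[OF m tracks_maps[OF fj[OF that(1)] that(2)]] by simp
    ultimately show "\<exists>h. tracks ?l m h \<and> (\<forall>j\<in>Ob J. \<forall>x\<in>carrier (Do j). (h (i j x), f j x) \<in> snd m)"
      by blast
  qed
  then show ?thesis by blast
qed

end

lemma complete_Equ:
  assumes u: "universe TYPE('u)"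
  shows "complete_category TYPE('u) E"
  unfolding complete_category_def
proof (intro allI impI)
  fix J :: "('u, 'u) cat" and Do Da assume D: "small_diagram J E Do Da"
  show "\<exists>l \<pi>. is_limit J E Do Da l \<pi>"
  proof (rule diagram_representatives[OF D])
    show ?thesis if "\<And>k. k \<in> Ar J \<Longrightarrow> tracks (Do (Dom J k)) (Do (Cod J k)) (d k)"
      "\<And>k. k \<in> Ar J \<Longrightarrow> Da k = arrow (Do (Dom J k)) (d k) (Do (Cod J k))"
      "\<And>j. j \<in> Ob J \<Longrightarrow> Do j \<in> Ob E" "\<And>k. k \<in> Ar J \<Longrightarrow> Dom J k \<in> Ob J \<and> Cod J k \<in> Ob J" for d
      using limit_exists[OF that(3,4,1,2) u] D by (simp add: small_diagram_def)
  qed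
qed

lemma cocomplete_Equ:
  assumes u: "universe TYPE('u)"
  shows "cocomplete_category TYPE('u) E"
  unfolding cocomplete_category_def
proof (intro allI impI)
  fix J :: "('u, 'u) cat" and Do Da assume D: "small_diagram J E Do Da"
  show "\<exists>l \<iota>. is_colimit J E Do Da l \<iota>"
  proof (rule diagram_representatives[OF D])
    show ?thesis if "\<And>k. k \<in> Ar J \<Longrightarrow> tracks (Do (Dom J k)) (Do (Cod J k)) (d k)"
      "\<And>k. k \<in> Ar J \<Longrightarrow> Da k = arrow (Do (Dom J k)) (d k) (Do (Cod J k))"
      "\<And>j. j \<in> Ob J \<Longrightarrow> Do j \<in> Ob E" "\<And>k. k \<in> Ar J \<Longrightarrow> Dom J k \<in> Ob J \<and> Cod J k \<in> Ob J" for d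
      using colimit_exists[OF that(3,4,1,2) u] D by (simp add: small_diagram_def)
  qed
qed


section \<open>Equalizers, coequalizers and the count of regular subobjects and quotients\<close>

text \<open>
  \<open>U\<close> collects the points where the representing functions agree up to equivalence. A function
  that equalizes the pair takes its values in \<open>U\<close>, and the initial structure on \<open>U\<close> makes it
  admissible into \<open>a\<close>.
\<close>

lemma is_equalizer_inclusion:
  assumes B: "B \<in> Ob E" and T: "T \<in> Ob E" and f: "tracks B T f" and g: "tracks B T g"
    and U: "U = {u \<in> carrier B. (f u, g u) \<in> snd T}"
    and a: "a \<in> Ob X" "Uo a = U" "admissible a (fst B) (\<lambda>u. u)"
    and initial: "\<And>z h. z \<in> Ob X \<Longrightarrow> h \<in> Uo z \<rightarrow> U \<Longrightarrow> admissible z (fst B) h \<Longrightarrow> admissible z a h"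
  shows "is_equalizer E (arrow B f T) (arrow B g T) (arrow (a, snd B \<inter> U \<times> U) (\<lambda>u. u) B)"
proof -
  let ?l = "(a, snd B \<inter> U \<times> U)"
  let ?i = "arrow ?l (\<lambda>u. u) B"
  have "{(v, w) \<in> U \<times> U. (v, w) \<in> snd B} = snd B \<inter> U \<times> U" by blast
  then have "equiv U (snd B \<inter> U \<times> U)"
    using equiv_pullback[OF B, of U "\<lambda>u. u"] U by simp
  then have l: "?l \<in> Ob E" using a by (simp add: Ob_Equ)
  have i: "tracks ?l B (\<lambda>u. u)" using a(3) by (auto simp: tracks_def)
  have ar: "?i \<in> Ar E" using arrow_hom[OF l B i] by (simp add: hom_def)
  have "(f u, g u) \<in> snd T" if "u \<in> U" for u using that U by blast
  then have eq: "Comp E (arrow B f T) ?i = Comp E (arrow B g T) ?i"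
    unfolding Comp_arrow[OF l B T i f] Comp_arrow[OF l B T i g]
    using arrow_eq_iff[OF l T tracks_comp[OF i f] tracks_comp[OF i g]] a(2) by simp
  have "\<exists>!k. k \<in> hom E z ?l \<and> Comp E ?i k = h"
    if z: "z \<in> Ob E" and h: "h \<in> hom E z B" and fg: "Comp E (arrow B f T) h = Comp E (arrow B g T) h" for z h
  proof -
    obtain h' where h': "tracks z B h'" "h = arrow z h' B" using h unfolding hom_Equ by blast
    have "(f (h' u), g (h' u)) \<in> snd T" if "u \<in> carrier z" for u
      using fg that unfolding h'(2) Comp_arrow[OF z B T h'(1) f] Comp_arrow[OF z B T h'(1) g]
        arrow_eq_iff[OF z T tracks_comp[OF h'(1) f] tracks_comp[OF h'(1) g]] by blast
    then have h'_U: "h' u \<in> U" if "u \<in> carrier z" for u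
      using that tracks_maps[OF h'(1)] U by blast
    have "admissible (fst z) a h'"
      using initial[of "fst z" h'] h'_U z h'(1) by (auto simp: Ob_Equ tracks_def)
    moreover have "(h' u, h' v) \<in> snd B \<inter> U \<times> U" if "(u, v) \<in> snd z" for u v
      using tracks_related[OF h'(1) that] h'_U equ_carrier[OF z that] by blast
    ultimately have k: "tracks z ?l h'" by (auto simp: tracks_def)
    show ?thesis
    proof (rule ex1I[of _ "arrow z h' ?l"])
      show "arrow z h' ?l \<in> hom E z ?l \<and> Comp E ?i (arrow z h' ?l) = h"
        using arrow_hom[OF z l k] Comp_arrow[OF z l B k i] h'(2) by simp
      fix k' assume k': "k' \<in> hom E z ?l \<and> Comp E ?i k' = h"
      then obtain q where q: "tracks z ?l q" "k' = arrow z q ?l" unfolding hom_Equ by blast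
      have "arrow z q B = arrow z h' B"
        using k' Comp_arrow[OF z l B q(1) i] unfolding q(2) h'(2) by simp
      then have "(q u, h' u) \<in> snd B" if "u \<in> carrier z" for u
        using arrow_eq_iff[OF z B tracks_comp[OF q(1) i] h'(1)] that by blast
      then have "(q u, h' u) \<in> snd ?l" if "u \<in> carrier z" for u
        using that h'_U tracks_maps[OF q(1) that] a(2) by auto
      then show "k' = arrow z h' ?l" using arrow_eq_iff[OF z l q(1) k] q(2) by blast
    qed
  qed
  then show ?thesis unfolding is_equalizer_def using ar eq by simp
qed

text \<open>
  A structure on every subset is chosen once and for all, so that the canonical equalizer depends on the
  subset alone.
\<close>

lemma regular_well_powered_Equ:
  assumes u: "universe TYPE('u)"
  shows "regular_well_powered TYPE('u) E"
  unfolding regular_well_powered_def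
proof
  fix B assume B: "B \<in> Ob E"
  have small_B: "small TYPE('u) (carrier B)" using B small_Uo by (simp add: Ob_Equ)
  let ?sub = "\<lambda>U a. a \<in> Ob X \<and> Uo a = U \<and> admissible a (fst B) (\<lambda>u. u) \<and>
    (\<forall>z h. z \<in> Ob X \<longrightarrow> h \<in> Uo z \<rightarrow> U \<longrightarrow> admissible z (fst B) h \<longrightarrow> admissible z a h)"
  have "\<exists>a. ?sub U a" if U: "U \<subseteq> carrier B" for U
  proof (rule initial_lift[where A = U and S = "{(fst B, \<lambda>u. u)}"])
    show "small TYPE('u) U" using small_subset[OF small_B U] .
    show "y \<in> Ob X \<and> g \<in> U \<rightarrow> Uo y" if "(y, g) \<in> {(fst B, \<lambda>u. u)}" for y g
      using that B U by (auto simp: Ob_Equ)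
  qed auto
  then obtain a where a: "\<And>U. U \<subseteq> carrier B \<Longrightarrow> ?sub U (a U)" by metis
  show "small TYPE('u) (regular_monos_into E B // iso_over E B)"
  proof (rule category.small_regular_subobjects[OF category_E small_Pow[OF u small_B]])
    fix T f g assume T: "T \<in> Ob E" and fg: "f \<in> hom E B T" "g \<in> hom E B T"
    obtain f' g' where f': "tracks B T f'" "f = arrow B f' T" and g': "tracks B T g'" "g = arrow B g' T"
      using fg unfolding hom_Equ by blast
    let ?U = "{u \<in> carrier B. (f' u, g' u) \<in> snd T}"
    have aU: "?sub ?U (a ?U)" by (rule a) blast
    have "is_equalizer E f g (arrow (a ?U, snd B \<inter> ?U \<times> ?U) (\<lambda>u. u) B)"
      unfolding f'(2) g'(2) by (rule is_equalizer_inclusion[OF B T f'(1) g'(1) refl]) (use aU in blast)+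
    then show "\<exists>U\<in>Pow (carrier B). Cod E (arrow (a U, snd B \<inter> U \<times> U) (\<lambda>u. u) B) = B \<and>
        is_equalizer E f g (arrow (a U, snd B \<inter> U \<times> U) (\<lambda>u. u) B)"
      by (intro bexI[of _ ?U]) auto
  qed
qed

text \<open>
  Identifying \<open>f u\<close> with \<open>g u\<close> changes the relation only; the identity function represents the
  coequalizer. Factoring through it means that the same representing function respects the coarser
  relation.
\<close>

lemma is_coequalizer_coarsening:
  assumes B: "B \<in> Ob E" and T: "T \<in> Ob E" and f: "tracks T B f" and g: "tracks T B g"
    and R: "R = generated_equiv (carrier B) (snd B \<union> (\<lambda>u. (f u, g u)) ` carrier T)"
  shows "is_coequalizer E (arrow T f B) (arrow T g B) (arrow B (\<lambda>u. u) (fst B, R))"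
proof -
  let ?l = "(fst B, R)"
  let ?e = "arrow B (\<lambda>u. u) ?l"
  let ?G = "snd B \<union> (\<lambda>u. (f u, g u)) ` carrier T"
  have "?G \<subseteq> carrier B \<times> carrier B"
    using equ_carrier[OF B] tracks_maps[OF f] tracks_maps[OF g] by auto
  then have G: "?G \<subseteq> R" unfolding R by (rule generated_equiv_contains)
  have l: "?l \<in> Ob E" using B equiv_generated_equiv R by (simp add: Ob_Equ)
  have e: "tracks B ?l (\<lambda>u. u)" using G B admissible_id by (auto simp: tracks_def Ob_Equ)
  have ar: "?e \<in> Ar E" using arrow_hom[OF B l e] by (simp add: hom_def)
  have eq: "Comp E ?e (arrow T f B) = Comp E ?e (arrow T g B)"
    unfolding Comp_arrow[OF T B l f e] Comp_arrow[OF T B l g e]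
    using arrow_eq_iff[OF T l tracks_comp[OF f e] tracks_comp[OF g e]] G by auto
  have "\<exists>!k. k \<in> hom E ?l z \<and> Comp E k ?e = h"
    if z: "z \<in> Ob E" and h: "h \<in> hom E B z" and fg: "Comp E h (arrow T f B) = Comp E h (arrow T g B)" for z h
  proof -
    obtain h' where h': "tracks B z h'" "h = arrow B h' z" using h unfolding hom_Equ by blast
    have "(h' (f u), h' (g u)) \<in> snd z" if "u \<in> carrier T" for u
      using fg that unfolding h'(2) Comp_arrow[OF T B z f h'(1)] Comp_arrow[OF T B z g h'(1)]
        arrow_eq_iff[OF T z tracks_comp[OF f h'(1)] tracks_comp[OF g h'(1)]] by blast
    then have "?G \<subseteq> {(v, w) \<in> carrier B \<times> carrier B. (h' v, h' w) \<in> snd z}"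
      using tracks_related[OF h'(1)] equ_carrier[OF B] tracks_maps[OF f] tracks_maps[OF g] by auto
    moreover have "equiv (carrier B) {(v, w) \<in> carrier B \<times> carrier B. (h' v, h' w) \<in> snd z}"
      by (rule equiv_pullback[OF z]) (rule tracks_maps[OF h'(1)])
    ultimately have "R \<subseteq> {(v, w) \<in> carrier B \<times> carrier B. (h' v, h' w) \<in> snd z}"
      unfolding R by (intro generated_equiv_least)
    then have k: "tracks ?l z h'" using h'(1) by (auto simp: tracks_def)
    show ?thesis
    proof (rule ex1I[of _ "arrow ?l h' z"])
      show "arrow ?l h' z \<in> hom E ?l z \<and> Comp E (arrow ?l h' z) ?e = h"
        using arrow_hom[OF l z k] Comp_arrow[OF B l z e k] h'(2) by simp
      fix k' assume k': "k' \<in> hom E ?l z \<and> Comp E k' ?e = h"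
      then obtain q where q: "tracks ?l z q" "k' = arrow ?l q z" unfolding hom_Equ by blast
      have "arrow B q z = arrow B h' z"
        using k' Comp_arrow[OF B l z e q(1)] unfolding q(2) h'(2) by simp
      then have "(q u, h' u) \<in> snd z" if "u \<in> carrier B" for u
        using arrow_eq_iff[OF B z tracks_comp[OF e q(1)] h'(1)] that by blast
      then show "k' = arrow ?l h' z" using arrow_eq_iff[OF l z q(1) k] q(2) by simp
    qed
  qed
  then show ?thesis unfolding is_coequalizer_def using ar eq by simp
qed

lemma regular_co_well_powered_Equ:
  assumes u: "universe TYPE('u)"
  shows "regular_co_well_powered TYPE('u) E"
  unfolding regular_co_well_powered_def
proof
  fix B assume B: "B \<in> Ob E"
  have small_B: "small TYPE('u) (carrier B)" using B small_Uo by (simp add: Ob_Equ)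
  show "small TYPE('u) (regular_epis_from E B // iso_under E B)"
  proof (rule category.small_regular_quotients[OF category_E small_Pow[OF u small_Sigma[OF u small_B small_B]]])
    fix T f g assume T: "T \<in> Ob E" and fg: "f \<in> hom E T B" "g \<in> hom E T B"
    obtain f' g' where f': "tracks T B f'" "f = arrow T f' B" and g': "tracks T B g'" "g = arrow T g' B"
      using fg unfolding hom_Equ by blast
    let ?R = "generated_equiv (carrier B) (snd B \<union> (\<lambda>u. (f' u, g' u)) ` carrier T)"
    have "is_coequalizer E f g (arrow B (\<lambda>u. u) (fst B, ?R))"
      unfolding f'(2) g'(2) by (rule is_coequalizer_coarsening[OF B T f'(1) g'(1) refl])
    moreover have "?R \<subseteq> carrier B \<times> carrier B" by (auto simp: generated_equiv_def)
    ultimately show "\<exists>R\<in>Pow (carrier B \<times> carrier B). Dom E (arrow B (\<lambda>u. u) (fst B, R)) = B \<and>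
        is_coequalizer E f g (arrow B (\<lambda>u. u) (fst B, R))"
      by (intro bexI[of _ ?R]) auto
  qed
qed

end

theorem theorem1p1:
  fixes X :: "('o, 'a) cat"
    and Uo :: "'o \<Rightarrow> 'u set"
    and Ua :: "'a \<Rightarrow> 'u map"
  assumes "universe TYPE('u)"
    and "category X"
    and "topological X Sets Uo Ua"
  shows "complete_category TYPE('u) (Equ X Uo Ua) \<and>
    cocomplete_category TYPE('u) (Equ X Uo Ua) \<and>
    regular_well_powered TYPE('u) (Equ X Uo Ua) \<and>
    regular_co_well_powered TYPE('u) (Equ X Uo Ua)"
proof -
  interpret topological_over_sets X Uo Ua
    using assms(2,3) by (simp add: topological_over_sets_def topological_over_sets_axioms_def)
  show ?thesis
    using complete_Equ cocomplete_Equ regular_well_powered_Equ regular_co_well_powered_Equ assms(1)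
    by blast
qed

end
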